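(* For every integer $a\ge 3$, $g(a)\le 6a-12$.
   Context: A convex polyhedron is an intersection of finitely many closed halfplanes in $\mathbb{R}^2$; its facets are its one-dimensional faces (edges, which may be segments, rays or lines). For pairwise disjoint nonempty compact convex sets $D_1,\dots,D_a\subseteq\mathbb{R}^2$, a separating system is a family $\{P_1,\dots,P_a\}$ of convex polyhedra with $D_i\subseteq P_i$ for all $i$ and $P_i^{\circ}\cap P_j^{\circ}=\emptyset$ for $i\ne j$; its facet count $\mathrm{Fac}$ is the total number of facets of $P_1,\dots,P_a$. For an integer $a\ge1$, $g(a)$ is the smallest integer such that every family of $a$ pairwise disjoint such convex sets in $\mathbb{R}^2$ admits a separating system with $\mathrm{Fac}\le g(a)$. *)

theory Defs
  imports "HOL-Analysis.Analysis" "HOL-Library.Extended_Nat"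
begin

definition disjoint_convex_family :: "nat \<Rightarrow> (nat \<Rightarrow> (real^2) set) \<Rightarrow> bool" where
  "disjoint_convex_family a D \<longleftrightarrow>
     (\<forall>i\<in>{1..a}. D i \<noteq> {} \<and> compact (D i) \<and> convex (D i)) \<and>
     disjoint_family_on D {1..a}"

definition separating_system ::
    "nat \<Rightarrow> (nat \<Rightarrow> (real^2) set) \<Rightarrow> (nat \<Rightarrow> (real^2) set) \<Rightarrow> bool" where
  "separating_system a D P \<longleftrightarrow>
     (\<forall>i\<in>{1..a}. polyhedron (P i) \<and> D i \<subseteq> P i) \<and>
     disjoint_family_on (\<lambda>i. interior (P i)) {1..a}"

(* A facet is a face of affine dimension 1, which is the library's edge_of; the library's facet_of
   (codimension 1 relative to the affine hull) differs on polyhedra with empty interior.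
   The whole plane has no facets. An edge shared by P i and P j is counted twice. *)
definition Fac :: "nat \<Rightarrow> (nat \<Rightarrow> (real^2) set) \<Rightarrow> nat" where
  "Fac a P = (\<Sum>i\<in>{1..a}. card {F. F edge_of P i})"

(* The infimum in enat is the least such m if there is one, and infinity otherwise. *)
definition g :: "nat \<Rightarrow> enat" where
  "g a = Inf {enat m | m. \<forall>D. disjoint_convex_family a D \<longrightarrow>
                            (\<exists>P. separating_system a D P \<and> Fac a P \<le> m)}"

end

(* Enlarge the given sets to a maximal family of pairwise disjoint open convex cells U i (Zorn) and
   take P i = closure (U i). Maximality makes P i an intersection of separating halfplanes, and it
   forces every edge F of P i to be touched, at a relatively interior point q, by some other P k:
   otherwise each P k could be separated from P i by a line missing a fixed point m of F, and U i
   could be enlarged to contain m. A line separating P i from P k must then contain F, so for fixed i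
   the edge F is determined by k.

   It remains to see that the touching pairs {i, k} number at most 3a - 6. Cut the plane by the lines
   u . p = x for a direction u orthogonal to no edge. Each line meets the cells in a linear order,
   and near q one finds a line on which i is adjacent to some k touching F at q. When x moves, cells
   enter and leave this order one at a time, and counting the adjacencies so created gives the
   bound. The sweep replaces Euler's formula for the planar contact graph. *)
theory Submission
  imports Defs
begin

section \<open>Adjacencies in a sweep of linear orders\<close>

text \<open>Arbitrarily many closed cells can share a point, so the pairs of cells whose closures
  meet are not bounded by 3a - 6. Each edge is therefore charged to a single partner, taken from
  adjacencies on lines, where a cell has at most one neighbour on either side. The lines must cross
  every edge transversally so that those passing near the contact point, on both sides of it, still
  meet the cell. Cells may be unbounded, so compactness does not supply a contact point. It comes
  instead from duality for finite linear systems, which is why the closures are shown to be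
  polyhedra before contact is discussed. Both cells of an adjacency may charge an edge to it, whence
  6a - 12 = 2(3a - 6).\<close>

definition lin_on :: "('a \<Rightarrow> 'a \<Rightarrow> bool) \<Rightarrow> 'a set \<Rightarrow> bool" where
  "lin_on R S \<longleftrightarrow> (\<exists>h::'a \<Rightarrow> real. inj_on h S \<and> (\<forall>i\<in>S. \<forall>k\<in>S. R i k \<longleftrightarrow> h i < h k))"

definition adj :: "('a \<Rightarrow> 'a \<Rightarrow> bool) \<Rightarrow> 'a set \<Rightarrow> ('a \<times> 'a) set" where
  "adj R S = {(i, k). i \<in> S \<and> k \<in> S \<and> R i k \<and> (\<forall>m\<in>S. \<not> (R i m \<and> R m k))}"

definition is_min :: "('a \<Rightarrow> 'a \<Rightarrow> bool) \<Rightarrow> 'a set \<Rightarrow> 'a \<Rightarrow> bool" where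
  "is_min R S b \<longleftrightarrow> b \<in> S \<and> (\<forall>i\<in>S. \<not> R i b)"

definition is_max :: "('a \<Rightarrow> 'a \<Rightarrow> bool) \<Rightarrow> 'a set \<Rightarrow> 'a \<Rightarrow> bool" where
  "is_max R S t \<longleftrightarrow> t \<in> S \<and> (\<forall>i\<in>S. \<not> R t i)"

lemma lin_on_subset: "lin_on R S \<Longrightarrow> T \<subseteq> S \<Longrightarrow> lin_on R T"
  unfolding lin_on_def by (meson inj_on_subset subsetD)

lemma lin_onE:
  assumes "lin_on R S"
  obtains h :: "'a \<Rightarrow> real" where "\<And>i k. i \<in> S \<Longrightarrow> k \<in> S \<Longrightarrow> h i = h k \<Longrightarrow> i = k"
    "\<And>i k. i \<in> S \<Longrightarrow> k \<in> S \<Longrightarrow> R i k \<longleftrightarrow> h i < h k"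
  using assms unfolding lin_on_def inj_on_def by metis

lemma lin_on_trichotomy:
  assumes "lin_on R S" "i \<in> S" "k \<in> S"
  shows "i = k \<or> R i k \<or> R k i"
proof -
  obtain h :: "'a \<Rightarrow> real" where h: "\<And>i k. i \<in> S \<Longrightarrow> k \<in> S \<Longrightarrow> h i = h k \<Longrightarrow> i = k"
    "\<And>i k. i \<in> S \<Longrightarrow> k \<in> S \<Longrightarrow> R i k \<longleftrightarrow> h i < h k" using lin_onE[OF assms(1)] by metis
  then show ?thesis using assms(2,3) by (metis linorder_less_linear)
qed

lemma lin_on_irrefl: "lin_on R S \<Longrightarrow> i \<in> S \<Longrightarrow> \<not> R i i"
  unfolding lin_on_def by auto

lemma lin_on_asym: "lin_on R S \<Longrightarrow> i \<in> S \<Longrightarrow> k \<in> S \<Longrightarrow> R i k \<Longrightarrow> \<not> R k i"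
  unfolding lin_on_def by fastforce

lemma lin_on_trans: "lin_on R S \<Longrightarrow> i \<in> S \<Longrightarrow> k \<in> S \<Longrightarrow> m \<in> S \<Longrightarrow> R i k \<Longrightarrow> R k m \<Longrightarrow> R i m"
  unfolding lin_on_def by (metis order_less_trans)

lemma adj_subset: "adj R S \<subseteq> S \<times> S"
  by (auto simp: adj_def)

lemma finite_adj: "finite S \<Longrightarrow> finite (adj R S)"
  by (meson adj_subset finite_cartesian_product finite_subset)

lemma adj_eq_empty:
  assumes "lin_on R S" "finite S" "card S \<le> 1"
  shows "adj R S = {}"
proof -
  have "i = k" if "i \<in> S" "k \<in> S" for i k
    using assms(2,3) that card_le_Suc0_iff_eq[of S] by simp
  then show ?thesis using lin_on_irrefl[OF assms(1)] by (auto simp: adj_def)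
qed

lemma adj_below_unique:
  assumes "lin_on R S" "(j, i) \<in> adj R S" "(k, i) \<in> adj R S"
  shows "j = k"
  using assms lin_on_trichotomy[OF assms(1), of j k] by (auto simp: adj_def)

lemma adj_above_unique:
  assumes "lin_on R S" "(i, j) \<in> adj R S" "(i, k) \<in> adj R S"
  shows "j = k"
  using assms lin_on_trichotomy[OF assms(1), of j k] by (auto simp: adj_def)

lemma card_le_one:
  assumes "\<And>x y. x \<in> T \<Longrightarrow> y \<in> T \<Longrightarrow> x = y"
  shows "card T \<le> 1"
proof (cases "T = {}")
  case False
  then obtain x where "x \<in> T" by blast
  then have "T = {x}" using assms by blast
  then show ?thesis by simp
qed simp

lemma adj_insert_split:
  "adj R (insert i S) \<subseteq> adj R S \<union> {p \<in> adj R (insert i S). snd p = i} \<union> {p \<in> adj R (insert i S). fst p = i}"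
  by (auto simp: adj_def)

text \<open>Insertion can break old adjacencies, but every new one involves \<open>i\<close>, which
  has at most one neighbour on each side and, if it is extreme, none on one of them.\<close>

lemma card_adj_insert:
  assumes lin: "lin_on R (insert i S)" and "finite E" "adj R S \<subseteq> E"
  shows "card (E \<union> adj R (insert i S)) \<le> card E + 2"
    and "is_min R (insert i S) i \<or> is_max R (insert i S) i \<Longrightarrow>
           card (E \<union> adj R (insert i S)) \<le> card E + 1"
proof -
  let ?B = "{p \<in> adj R (insert i S). snd p = i}" and ?A = "{p \<in> adj R (insert i S). fst p = i}"
  have B: "card ?B \<le> 1"
    by (rule card_le_one) (use adj_below_unique[OF lin] in \<open>auto simp: prod_eq_iff\<close>)
  have A: "card ?A \<le> 1"
    by (rule card_le_one) (use adj_above_unique[OF lin] in \<open>auto simp: prod_eq_iff\<close>)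
  have eq: "E \<union> adj R (insert i S) = E \<union> (?B \<union> ?A)"
    using adj_insert_split[of R i S] assms(3) by blast
  have le: "card (E \<union> adj R (insert i S)) \<le> card E + (card ?B + card ?A)"
    unfolding eq by (meson card_Un_le add_left_mono order_trans)
  then show "card (E \<union> adj R (insert i S)) \<le> card E + 2" using A B by linarith
  assume "is_min R (insert i S) i \<or> is_max R (insert i S) i"
  then have "?B = {} \<or> ?A = {}"
    by (fastforce simp: adj_def is_min_def is_max_def)
  then have "card ?B + card ?A \<le> 1" using A B by (elim disjE) (simp_all only: card.empty add_0 add_0_right)
  then show "card (E \<union> adj R (insert i S)) \<le> card E + 1"
    using le by (meson add_left_mono order_trans)
qed

text \<open>If only \<open>i\<close> kept \<open>j\<close> and \<open>k\<close> apart, then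
  \<open>i\<close> lies between them, and anything between \<open>j\<close> and \<open>i\<close> or
  between \<open>i\<close> and \<open>k\<close> would by transitivity keep them apart as
  well.\<close>

lemma adj_remove_new:
  assumes lin: "lin_on R S" and i: "i \<in> S"
    and "(j, k) \<in> adj R (S - {i})" "(j, k) \<notin> adj R S"
  shows "(j, i) \<in> adj R S \<and> (i, k) \<in> adj R S"
proof -
  have jk: "j \<in> S" "k \<in> S" "j \<noteq> i" "k \<noteq> i" "R j k" and no: "\<And>m. m \<in> S \<Longrightarrow> m \<noteq> i \<Longrightarrow> \<not> (R j m \<and> R m k)"
    using assms(3) by (auto simp: adj_def)
  then have ji: "R j i" "R i k" using assms(4) i by (auto simp: adj_def)
  have "\<not> (R j m \<and> R m i)" if "m \<in> S" for m
    using no[OF that] ji that lin_on_trans[OF lin that i jk(2)] lin_on_irrefl[OF lin i] by blast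
  moreover have "\<not> (R i m \<and> R m k)" if "m \<in> S" for m
    using no[OF that] ji that lin_on_trans[OF lin jk(1) i that] lin_on_irrefl[OF lin i] by blast
  ultimately show ?thesis using ji jk i by (auto simp: adj_def)
qed

lemma card_adj_remove:
  assumes lin: "lin_on R S" and i: "i \<in> S" and "finite E" "adj R S \<subseteq> E"
  shows "card (E \<union> adj R (S - {i})) \<le> card E + 1"
    and "is_min R S i \<or> is_max R S i \<Longrightarrow> E \<union> adj R (S - {i}) = E"
proof -
  let ?N = "adj R (S - {i}) - adj R S"
  have "card ?N \<le> 1"
  proof (rule card_le_one)
    fix p p' assume p: "p \<in> ?N" "p' \<in> ?N"
    have "(fst p, i) \<in> adj R S \<and> (i, snd p) \<in> adj R S" "(fst p', i) \<in> adj R S \<and> (i, snd p') \<in> adj R S"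
      using adj_remove_new[OF lin i, of "fst p" "snd p"] adj_remove_new[OF lin i, of "fst p'" "snd p'"] p
      by auto
    then show "p = p'"
      using adj_below_unique[OF lin] adj_above_unique[OF lin] by (auto intro: prod_eqI)
  qed
  moreover have eq: "E \<union> adj R (S - {i}) = E \<union> ?N" using assms(4) by blast
  ultimately show "card (E \<union> adj R (S - {i})) \<le> card E + 1"
    by (metis card_Un_le add_left_mono order_trans)
  assume "is_min R S i \<or> is_max R S i"
  moreover have "(j, i) \<in> adj R S \<Longrightarrow> (i, k) \<in> adj R S \<Longrightarrow> \<not> (is_min R S i \<or> is_max R S i)" for j k
    by (auto simp: adj_def is_min_def is_max_def)
  ultimately have "?N = {}" using adj_remove_new[OF lin i] by (metis DiffE equals0I surj_pair)
  then show "E \<union> adj R (S - {i}) = E" using assms(4) by blast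
qed

text \<open>\<open>S\<close> is the current order, \<open>A\<close> collects everything that has
  ever entered, and \<open>E\<close> all adjacencies seen so far. The condition
  \<open>i \<notin> A\<close> forbids a second entry; it is what makes a bound in terms of
  \<open>card A\<close> possible.\<close>

inductive sweep :: "('a \<Rightarrow> 'a \<Rightarrow> bool) \<Rightarrow> 'a set \<Rightarrow> 'a set \<Rightarrow> ('a \<times> 'a) set \<Rightarrow> bool" for R where
  start: "sweep R {} {} {}"
| enter: "sweep R S A E \<Longrightarrow> i \<notin> A \<Longrightarrow> lin_on R (insert i S) \<Longrightarrow>
            sweep R (insert i S) (insert i A) (E \<union> adj R (insert i S))"
| leave: "sweep R S A E \<Longrightarrow> i \<in> S \<Longrightarrow> sweep R (S - {i}) A (E \<union> adj R (S - {i}))"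

lemma sweep_basic:
  assumes "sweep R S A E"
  shows "finite A \<and> S \<subseteq> A \<and> lin_on R S \<and> finite E \<and> adj R S \<subseteq> E"
  using assms
proof induction
  case start
  then show ?case by (simp add: lin_on_def adj_def)
next
  case (enter S A E i)
  moreover have "finite (insert i S)" using enter by (meson finite_insert finite_subset)
  ultimately show ?case using finite_adj[of "insert i S" R] by blast
next
  case (leave S A E i)
  moreover have "finite (S - {i})" using leave by (meson finite_Diff finite_subset)
  ultimately show ?case using finite_adj[of "S - {i}" R] lin_on_subset[of R S "S - {i}"] by blast
qed

lemma is_min_insert:
  assumes lin: "lin_on R (insert i S)" and "is_min R S b" "\<not> is_min R (insert i S) i"
  shows "is_min R (insert i S) b"
proof -
  have b: "b \<in> S" "\<And>j. j \<in> S \<Longrightarrow> \<not> R j b" using assms(2) by (auto simp: is_min_def)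
  obtain j where j: "j \<in> insert i S" "R j i" using assms(3) by (auto simp: is_min_def)
  have "\<not> R i b"
  proof
    assume "R i b"
    then have "R j b" using lin_on_trans[OF lin j(1), of i b] j b by blast
    then show False using b j \<open>R i b\<close> lin_on_irrefl[OF lin, of i] by blast
  qed
  then show ?thesis using b by (auto simp: is_min_def)
qed

lemma is_max_insert:
  assumes lin: "lin_on R (insert i S)" and "is_max R S b" "\<not> is_max R (insert i S) i"
  shows "is_max R (insert i S) b"
proof -
  have b: "b \<in> S" "\<And>j. j \<in> S \<Longrightarrow> \<not> R b j" using assms(2) by (auto simp: is_max_def)
  obtain j where j: "j \<in> insert i S" "R i j" using assms(3) by (auto simp: is_max_def)
  have "\<not> R b i"
  proof
    assume "R b i"
    then have "R b j" using lin_on_trans[OF lin _ _ j(1), of b i] j b by blast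
    then show False using b j \<open>R b i\<close> lin_on_irrefl[OF lin, of i] by blast
  qed
  then show ?thesis using b by (auto simp: is_max_def)
qed

text \<open>Entering creates at most two adjacencies and leaving at most one, with one less when the element
  concerned is extreme. This alone gives \<open>3n - 5\<close>; the last unit comes from the second alternative:
  if no extreme element has entered or left since the first two elements entered, then these two are
  still the extremes and their adjacency is already in \<open>E\<close> when it reappears at the end.\<close>

definition sweep_bound :: "('a \<Rightarrow> 'a \<Rightarrow> bool) \<Rightarrow> 'a set \<Rightarrow> 'a set \<Rightarrow> ('a \<times> 'a) set \<Rightarrow> bool" where
  "sweep_bound R S A E \<longleftrightarrow>
     (card A \<le> 1 \<longrightarrow> E = {}) \<and> (card A = 2 \<longrightarrow> card E \<le> 1) \<and>
     (card A \<ge> 3 \<longrightarrow> card E + max (card S) 2 + 4 \<le> 3 * card A \<or>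
        (card S \<ge> 3 \<and> card E + card S + 3 \<le> 3 * card A \<and>
          (\<exists>b t. is_min R S b \<and> is_max R S t \<and> (b, t) \<in> E)))"

text \<open>On entry \<open>card E + card S\<close> grows by at most 3, which is also what
  \<open>3 * card A\<close> gains, so the alternatives persist. The delicate case is the entry of
  the third element, where the bound starts to count.\<close>

lemma sweep_bound_enter:
  assumes sw: "sweep R S A E" and i: "i \<notin> A" and lin: "lin_on R (insert i S)"
    and IH: "sweep_bound R S A E"
  shows "sweep_bound R (insert i S) (insert i A) (E \<union> adj R (insert i S))"
proof -
  note b = sweep_basic[OF sw]
  let ?E = "E \<union> adj R (insert i S)"
  have fin: "finite S" "finite A" using b finite_subset by auto
  have cS: "card (insert i S) = Suc (card S)" and cA: "card (insert i A) = Suc (card A)"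
    using fin i b by (auto simp: card_insert_if)
  have SA: "card S \<le> card A" using b card_mono by auto
  have le2: "card ?E \<le> card E + 2" and
    le1: "is_min R (insert i S) i \<or> is_max R (insert i S) i \<Longrightarrow> card ?E \<le> card E + 1"
    using card_adj_insert[OF lin, of E] b by auto
  have small: "is_min R (insert i S) i \<or> is_max R (insert i S) i" if "card S \<le> 1"
  proof -
    have "\<forall>j\<in>S. \<forall>k\<in>S. j = k" using that fin(1) by (simp add: card_le_Suc0_iff_eq)
    then obtain j where "S \<subseteq> {j}" by blast
    then show ?thesis
      using lin_on_asym[OF lin, of i j] lin_on_irrefl[OF lin, of i] by (auto simp: is_min_def is_max_def)
  qed
  consider "card A = 0" | "card A = 1" | "card A = 2" | "card A \<ge> 3" by linarith
  then show ?thesis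
  proof cases
    case 1
    then have "S = {}" "E = {}" using IH b fin by (auto simp: sweep_bound_def)
    then show ?thesis using adj_eq_empty[OF lin] cA 1 by (simp add: sweep_bound_def)
  next
    case 2
    then have "E = {}" "card S \<le> 1" using IH SA by (auto simp: sweep_bound_def)
    then show ?thesis using le1[OF small] cA 2 by (simp add: sweep_bound_def)
  next
    case 3
    then have E: "card E \<le> 1" using IH by (auto simp: sweep_bound_def)
    consider "card S \<le> 1" | "card S = 2" "is_min R (insert i S) i \<or> is_max R (insert i S) i"
      | "card S = 2" "\<not> is_min R (insert i S) i" "\<not> is_max R (insert i S) i" using SA 3 by linarith
    then show ?thesis
    proof cases
      case 1
      then show ?thesis using le1[OF small] cA cS 3 E by (simp add: sweep_bound_def)
    next
      case 2
      then show ?thesis using le1 cA cS 3 E by (simp add: sweep_bound_def)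
    next
      \<comment> \<open>The newcomer lands between the two elements present. Up to three adjacencies
        have then been seen, and \<open>3 + 3 + 3 = 3 * 3\<close> just meets the second alternative
        while missing the first by one.\<close>
      case c: 3
      obtain p q where pq: "S = {p, q}" "p \<noteq> q" using c(1) by (meson card_2_iff)
      have linS: "lin_on R S" using b by blast
      define l u where "l = (if R p q then p else q)" and "u = (if R p q then q else p)"
      have lu: "is_min R S l" "is_max R S u" "(l, u) \<in> adj R S"
        using lin_on_trichotomy[OF linS, of p q] lin_on_asym[OF linS, of p q]
          lin_on_irrefl[OF linS] pq
        by (auto simp: l_def u_def is_min_def is_max_def adj_def)
      have "is_min R (insert i S) l" "is_max R (insert i S) u"
        using is_min_insert[OF lin] is_max_insert[OF lin] lu c by blast+
      then show ?thesis using le2 cA cS 3 E c lu b by (auto simp: sweep_bound_def)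
    qed
  next
    case 4
    consider "card E + max (card S) 2 + 4 \<le> 3 * card A"
      | b t where "card S \<ge> 3" "card E + card S + 3 \<le> 3 * card A"
          "is_min R S b" "is_max R S t" "(b, t) \<in> E"
      using IH 4 by (auto simp: sweep_bound_def)
    then show ?thesis
    proof cases
      case 1
      then show ?thesis using le2 cA cS 4 by (auto simp: sweep_bound_def max_def split: if_splits)
    next
      case c: 2
      show ?thesis
      proof (cases "is_min R (insert i S) i \<or> is_max R (insert i S) i")
        \<comment> \<open>A new extreme costs one adjacency instead of two, and the unit saved
          restores the first alternative.\<close>
        case True
        then show ?thesis using le1 cA cS 4 c by (simp add: sweep_bound_def)
      next
        case False
        then have "is_min R (insert i S) b" "is_max R (insert i S) t"
          using is_min_insert[OF lin] is_max_insert[OF lin] c by blast+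
        then show ?thesis using le2 cA cS 4 c by (auto simp: sweep_bound_def)
      qed
    qed
  qed
qed

text \<open>A departure trades one element for at most one adjacency, so
  \<open>card E + card S\<close> does not grow. With at most two elements present it creates no
  adjacency, which lets the bound keep \<open>max (card S) 2\<close> when fewer remain.\<close>

lemma sweep_bound_leave:
  assumes sw: "sweep R S A E" and i: "i \<in> S" and IH: "sweep_bound R S A E"
  shows "sweep_bound R (S - {i}) A (E \<union> adj R (S - {i}))"
proof -
  note b = sweep_basic[OF sw]
  let ?E = "E \<union> adj R (S - {i})"
  have lin: "lin_on R S" and lin': "lin_on R (S - {i})" using b lin_on_subset by blast+
  have fin: "finite S" "finite A" using b finite_subset by auto
  have cS: "Suc (card (S - {i})) = card S" using card_Suc_Diff1[OF fin(1) i] .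
  have SA: "card S \<le> card A" using b card_mono by auto
  have le1: "card ?E \<le> card E + 1" and
    le0: "is_min R S i \<or> is_max R S i \<Longrightarrow> ?E = E"
    using card_adj_remove[OF lin i, of E] b by auto
  have small: "?E = E" if "card S \<le> 2"
    using adj_eq_empty[OF lin'] that cS fin by simp
  consider "card A \<le> 2" | "card A \<ge> 3" by linarith
  then show ?thesis
  proof cases
    case 1
    then show ?thesis using IH SA small by (simp add: sweep_bound_def)
  next
    case 2
    consider "card E + max (card S) 2 + 4 \<le> 3 * card A"
      | b t where "card S \<ge> 3" "card E + card S + 3 \<le> 3 * card A"
          "is_min R S b" "is_max R S t" "(b, t) \<in> E"
      using IH 2 by (auto simp: sweep_bound_def)
    then show ?thesis
    proof cases
      case 1
      show ?thesis
      proof (cases "card S \<le> 2")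
        case True
        then show ?thesis using 1 2 small cS by (simp add: sweep_bound_def)
      next
        case False
        then show ?thesis using 1 2 le1 cS by (simp add: sweep_bound_def)
      qed
    next
      case c: 2
      consider "is_min R S i \<or> is_max R S i"
        | "\<not> is_min R S i" "\<not> is_max R S i" "card S = 3"
        | "\<not> is_min R S i" "\<not> is_max R S i" "card S \<ge> 4" using c(1) by linarith
      then show ?thesis
      proof cases
        case 1
        then show ?thesis using le0 cS c 2 by (simp add: sweep_bound_def)
      next
        case d: 2
        have bt: "b \<in> S - {i}" "t \<in> S - {i}" "b \<noteq> t"
        proof -
          show "b \<in> S - {i}" "t \<in> S - {i}" using c d by (auto simp: is_min_def is_max_def)
          show "b \<noteq> t"
            using c i d lin_on_trichotomy[OF lin i, of b] by (auto simp: is_min_def is_max_def)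
        qed
        have "card (S - {i}) = 2" using cS d by simp
        then have "S - {i} = {b, t}"
          using bt fin by (metis card_2_iff doubleton_eq_iff insert_iff singletonD)
        then have "adj R (S - {i}) \<subseteq> {(b, t)}"
          using c lin_on_irrefl[OF lin'] bt by (auto simp: adj_def is_min_def is_max_def)
        \<comment> \<open>Nothing new is recorded, so the drop of \<open>card S\<close> from 3 to 2
          supplies the unit that separates the two alternatives.\<close>
        then have "?E = E" using c by auto
        then show ?thesis using c d 2 cS by (simp add: sweep_bound_def)
      next
        case d: 3
        have "is_min R (S - {i}) b" "is_max R (S - {i}) t"
          using c d by (auto simp: is_min_def is_max_def)
        then show ?thesis using c d 2 cS le1 by (auto simp: sweep_bound_def)
      qed
    qed
  qed
qed

lemma sweep_imp_bound: "sweep R S A E \<Longrightarrow> sweep_bound R S A E"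
proof (induction rule: sweep.induct)
  case start
  then show ?case by (simp add: sweep_bound_def)
next
  case (enter S A E i)
  then show ?case using sweep_bound_enter by metis
next
  case (leave S A E i)
  then show ?case using sweep_bound_leave by metis
qed

text \<open>The 6 is 4 plus the least value 2 of \<open>max (card S) 2\<close>, or 3 plus
  \<open>card S \<ge> 3\<close> in the second alternative.\<close>

lemma sweep_card:
  assumes "sweep R S A E" "card A \<le> n" "n \<ge> 3"
  shows "card E \<le> 3 * n - 6"
proof -
  consider "card A \<le> 1" | "card A = 2" | "card A \<ge> 3" by linarith
  then show ?thesis
    using sweep_imp_bound[OF assms(1)] assms(2,3) by cases (auto simp: sweep_bound_def)
qed

section \<open>Running a sweep through prescribed slices\<close>

lemma sweep_remove:
  assumes "finite D" "D \<subseteq> S" "sweep R S A E"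
  shows "\<exists>E'. E \<subseteq> E' \<and> sweep R (S - D) A E'"
  using assms(1,2)
proof (induction D)
  case empty
  then show ?case using assms(3) by auto
next
  case (insert i D)
  then obtain E' where E': "E \<subseteq> E'" "sweep R (S - D) A E'" by auto
  have "sweep R (S - D - {i}) A (E' \<union> adj R (S - D - {i}))"
    using E'(2) insert by (intro sweep.leave) auto
  moreover have "S - D - {i} = S - insert i D" by blast
  ultimately show ?case using E'(1) by (metis sup.coboundedI1)
qed

lemma sweep_insert:
  assumes "finite D" "D \<inter> A = {}" "lin_on R (S \<union> D)" "sweep R S A E"
  shows "\<exists>E'. E \<subseteq> E' \<and> sweep R (S \<union> D) (A \<union> D) E'"
  using assms(1,2,3)
proof (induction D)
  case empty
  then show ?case using assms(4) by auto
next
  case (insert i D)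
  have "lin_on R (S \<union> D)" using insert.prems lin_on_subset by (metis Un_insert_right subset_insertI)
  then obtain E' where E': "E \<subseteq> E'" "sweep R (S \<union> D) (A \<union> D) E'" using insert by auto
  have "sweep R (insert i (S \<union> D)) (insert i (A \<union> D)) (E' \<union> adj R (insert i (S \<union> D)))"
    using E'(2) insert by (intro sweep.enter) auto
  then show ?case using E'(1) by (metis sup.coboundedI1 Un_insert_right)
qed

text \<open>All departures precede all arrivals, so every intermediate set is contained in
  \<open>S\<close> or in \<open>T\<close> and hence linearly ordered. The hypothesis on
  \<open>T \<inter> A\<close> says that nothing in \<open>T\<close> has already left.\<close>

lemma sweep_step:
  assumes sw: "sweep R S A E" and "finite T" "lin_on R T" "T \<inter> A \<subseteq> S"
  shows "\<exists>E'. E \<subseteq> E' \<and> sweep R T (A \<union> T) E'"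
proof -
  note b = sweep_basic[OF sw]
  have finS: "finite S" using b finite_subset by auto
  obtain E1 where E1: "E \<subseteq> E1" "sweep R (S - (S - T)) A E1"
    using sweep_remove[OF _ _ sw, of "S - T"] finS by auto
  have eq: "S - (S - T) \<union> (T - S) = T" "A \<union> (T - S) = A \<union> T" using b by auto
  have "(T - S) \<inter> A = {}" using assms(4) by blast
  then obtain E2 where "E1 \<subseteq> E2" "sweep R (S - (S - T) \<union> (T - S)) (A \<union> (T - S)) E2"
    using sweep_insert[OF _ _ _ E1(2), of "T - S"] assms(2,3) by (auto simp: eq)
  then show ?thesis using E1(1) eq by auto
qed

lemma sweep_exists:
  fixes X :: "'t::linorder set"
  assumes "finite X" "\<And>x. x \<in> X \<Longrightarrow> finite (S x)" "\<And>x. x \<in> X \<Longrightarrow> lin_on R (S x)"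
    and "\<And>x y z. x \<in> X \<Longrightarrow> y \<in> X \<Longrightarrow> z \<in> X \<Longrightarrow> x \<le> y \<Longrightarrow> y \<le> z \<Longrightarrow> S x \<inter> S z \<subseteq> S y"
  shows "\<exists>T E. sweep R T (\<Union>x\<in>X. S x) E \<and> (\<forall>x\<in>X. adj R (S x) \<subseteq> E) \<and> (X \<noteq> {} \<longrightarrow> T = S (Max X))"
  using assms
proof (induction X rule: finite_linorder_max_induct)
  case empty
  then show ?case using sweep.start by auto
next
  case (insert z X)
  then have "\<exists>T E. sweep R T (\<Union>x\<in>X. S x) E \<and> (\<forall>x\<in>X. adj R (S x) \<subseteq> E) \<and> (X \<noteq> {} \<longrightarrow> T = S (Max X))"
    by (intro insert.IH insert.prems insertI2)
  then obtain T E where TE: "sweep R T (\<Union>x\<in>X. S x) E" "\<forall>x\<in>X. adj R (S x) \<subseteq> E"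
    "X \<noteq> {} \<longrightarrow> T = S (Max X)" by blast
  \<comment> \<open>An element of the new slice that was seen at some earlier \<open>x\<close> also
    lies in the last slice, because \<open>Max X\<close> is between \<open>x\<close> and
    \<open>z\<close>. So nothing returns after leaving.\<close>
  have "S z \<inter> (\<Union>x\<in>X. S x) \<subseteq> T"
  proof
    fix i assume "i \<in> S z \<inter> (\<Union>x\<in>X. S x)"
    then obtain x where x: "x \<in> X" "i \<in> S x" "i \<in> S z" by blast
    then have "Max X \<in> X" using insert.hyps Max_in by blast
    then have "x \<le> Max X" "Max X \<le> z" using insert.hyps x by (auto simp: less_imp_le)
    then have "S x \<inter> S z \<subseteq> S (Max X)"
      using insert.prems(3)[of x "Max X" z] x(1) \<open>Max X \<in> X\<close> by blast
    then show "i \<in> T" using x TE(3) by blast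
  qed
  then obtain E' where E': "E \<subseteq> E'" "sweep R (S z) ((\<Union>x\<in>X. S x) \<union> S z) E'"
    using sweep_step[OF TE(1), of "S z"] insert.prems by auto
  have "Max (insert z X) = z"
    using insert.hyps by (intro Max_eqI) (auto simp: less_imp_le)
  moreover have "\<forall>x\<in>insert z X. adj R (S x) \<subseteq> E'" using sweep_basic[OF E'(2)] TE(2) E'(1) by blast
  moreover have "(\<Union>x\<in>X. S x) \<union> S z = (\<Union>x\<in>insert z X. S x)" by blast
  ultimately show ?case using E'(2) by metis
qed

lemma card_adjacent_pairs:
  fixes X :: "'t::linorder set"
  assumes "finite X" "finite I" "card I \<ge> 3"
    and "\<And>x. x \<in> X \<Longrightarrow> S x \<subseteq> I" "\<And>x. x \<in> X \<Longrightarrow> lin_on R (S x)"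
    and "\<And>x y z. x \<in> X \<Longrightarrow> y \<in> X \<Longrightarrow> z \<in> X \<Longrightarrow> x \<le> y \<Longrightarrow> y \<le> z \<Longrightarrow> S x \<inter> S z \<subseteq> S y"
  shows "card (\<Union>x\<in>X. adj R (S x)) \<le> 3 * card I - 6"
proof -
  have "\<And>x. x \<in> X \<Longrightarrow> finite (S x)" using assms(2,4) finite_subset by metis
  then obtain T E where TE: "sweep R T (\<Union>x\<in>X. S x) E" "\<forall>x\<in>X. adj R (S x) \<subseteq> E"
    using sweep_exists[of X S R] assms(1,5,6) by blast
  have "card (\<Union>x\<in>X. S x) \<le> card I" using assms(2,4) by (intro card_mono) auto
  then have "card E \<le> 3 * card I - 6" using sweep_card[OF TE(1)] assms(3) by blast
  moreover have "card (\<Union>x\<in>X. adj R (S x)) \<le> card E"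
    using TE sweep_basic[OF TE(1)] by (intro card_mono) auto
  ultimately show ?thesis by linarith
qed

lemma adj_below_exists:
  assumes lin: "lin_on R S" and "finite S" "i \<in> S" "k \<in> S" "R k i"
  shows "\<exists>j. (j, i) \<in> adj R S \<and> (j = k \<or> R k j)"
proof -
  obtain h :: "'a \<Rightarrow> real" where h: "\<And>i k. i \<in> S \<Longrightarrow> k \<in> S \<Longrightarrow> h i = h k \<Longrightarrow> i = k"
    "\<And>i k. i \<in> S \<Longrightarrow> k \<in> S \<Longrightarrow> R i k \<longleftrightarrow> h i < h k" using lin_onE[OF lin] by metis
  have fin: "finite {j \<in> S. R j i}" "{j \<in> S. R j i} \<noteq> {}" using assms by auto
  define j where "j = arg_min_on (\<lambda>m. - h m) {j \<in> S. R j i}"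
  have j: "j \<in> S" "R j i" "\<And>m. m \<in> S \<Longrightarrow> R m i \<Longrightarrow> h m \<le> h j"
    using arg_min_if_finite[OF fin, of "\<lambda>m. - h m"] unfolding j_def[symmetric] by (auto simp: not_less)
  then have "(j, i) \<in> adj R S" using h assms by (auto simp: adj_def) (metis leD)
  moreover have "j = k \<or> R k j" using j(3)[OF assms(4,5)] h j(1) assms(4) by force
  ultimately show ?thesis by blast
qed

section \<open>Polyhedra: separation or contact\<close>

text \<open>This is Farkas' lemma. With \<open>(v, r)\<close> read as
  \<open>v \<bullet> z \<le> r\<close>, the cone consists of consequences of the system;
  \<open>(0, 1)\<close> is the trivial inequality and \<open>(0, -1)\<close> the contradiction. A
  functional that separates \<open>(0, -1)\<close> from the closed cone has positive last
  coordinate, and normalising it gives a solution.\<close>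

lemma finite_system_feasible:
  fixes H :: "('a::euclidean_space \<times> real) set"
  assumes "finite H" and "(0, -1) \<notin> convex_cone hull (insert (0, 1) H)"
  shows "\<exists>z. \<forall>(v, r)\<in>H. v \<bullet> z \<le> r"
proof -
  let ?C = "convex_cone hull (insert (0, 1) H)"
  have "convex ?C" "closed ?C"
    using assms(1) by (auto simp: convex_convex_cone_hull closed_convex_cone_hull)
  then obtain f \<beta> where f: "f \<bullet> (0, -1) < \<beta>" "\<forall>x\<in>?C. f \<bullet> x > \<beta>"
    using separating_hyperplane_closed_point[of ?C "(0, -1)"] assms(2) by blast
  have "\<beta> < 0" using f(2) convex_cone_hull_contains_0 by fastforce
  have nonneg: "f \<bullet> x \<ge> 0" if "x \<in> ?C" for x
  proof (rule ccontr)
    assume "\<not> f \<bullet> x \<ge> 0"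
    \<comment> \<open>A negative value could be rescaled within the cone to be exactly
      \<open>\<beta>\<close>, which strict separation excludes.\<close>
    then have "(\<beta> / (f \<bullet> x)) *\<^sub>R x \<in> ?C"
      using that \<open>\<beta> < 0\<close> by (intro convex_cone_hull_mul) (auto simp: divide_nonpos_neg less_imp_le)
    then show False using f(2) \<open>\<not> f \<bullet> x \<ge> 0\<close> by fastforce
  qed
  obtain z t where ft: "f = (z, t)" by fastforce
  have t: "t > 0" using f(1) \<open>\<beta> < 0\<close> by (simp add: ft)
  have "v \<bullet> ((-1 / t) *\<^sub>R z) \<le> r" if "(v, r) \<in> H" for v r
  proof -
    have "z \<bullet> v + t * r \<ge> 0" using nonneg[of "(v, r)"] that by (simp add: ft hull_inc)
    then have "- (z \<bullet> v) \<le> r * t" by (simp add: mult.commute)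
    then have "- (z \<bullet> v) / t \<le> r" using t by (simp only: pos_divide_le_eq)
    then show ?thesis by (simp add: inner_commute)
  qed
  then show ?thesis by blast
qed

lemma polyhedron_inequalities:
  fixes P :: "'a::euclidean_space set"
  assumes "polyhedron P"
  obtains A where "finite A" "P = {x. \<forall>(a, b)\<in>A. a \<bullet> x \<le> b}"
proof -
  obtain F where F: "finite F" "P = \<Inter>F" "\<forall>h\<in>F. \<exists>a b. a \<noteq> 0 \<and> h = {x. a \<bullet> x \<le> b}"
    using assms unfolding polyhedron_def by blast
  then have "\<forall>h\<in>F. \<exists>p. h = {x. fst p \<bullet> x \<le> snd p}" by (metis fst_conv snd_conv)
  from bchoice[OF this] obtain p where p: "\<forall>h\<in>F. h = {x. fst (p h) \<bullet> x \<le> snd (p h)}" ..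
  have "P = {x. \<forall>(a, b)\<in>p ` F. a \<bullet> x \<le> b}"
    unfolding F(2) using p by (auto simp: case_prod_beta)
  then show ?thesis using that F(1) by blast
qed

text \<open>Homogenise: a point \<open>q\<close> of the second kind is \<open>(x + m) / (s + 1)\<close> for a solution
  \<open>(x, s)\<close> of a finite linear system; if that system is infeasible, its Farkas certificate is the
  separating functional.\<close>

lemma separation_or_contact:
  fixes P Q :: "'a::euclidean_space set"
  assumes "polyhedron P" "polyhedron Q" and m: "m \<in> P"
  shows "(\<exists>c \<beta>. (\<forall>x\<in>P. c \<bullet> x \<le> \<beta>) \<and> (\<forall>y\<in>Q. \<beta> \<le> c \<bullet> y) \<and> c \<bullet> m < \<beta>) \<or>
         (\<exists>q\<in>Q. \<exists>l>0. \<forall>v. m + v \<in> P \<longrightarrow> q + l *\<^sub>R v \<in> P)"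
proof -
  obtain A where A: "finite A" "P = {x. \<forall>(a, b)\<in>A. a \<bullet> x \<le> b}"
    by (rule polyhedron_inequalities[OF assms(1)])
  obtain B where B: "finite B" "Q = {x. \<forall>(a, b)\<in>B. a \<bullet> x \<le> b}"
    by (rule polyhedron_inequalities[OF assms(2)])
  \<comment> \<open>The unknown is a pair \<open>(x, s)\<close>. \<open>H1\<close> says
    \<open>s \<ge> 0\<close> and \<open>a \<bullet> x \<le> b * s\<close>, so that
    \<open>(x + m + v) / (s + 1)\<close> is in \<open>P\<close> whenever \<open>m + v\<close> is;
    \<open>H2\<close> puts \<open>(x + m) / (s + 1)\<close> into \<open>Q\<close>.\<close>
  define H1 :: "(('a \<times> real) \<times> real) set" where
    "H1 = insert ((0, -1), 0) ((\<lambda>(a, b). ((a, -b), 0)) ` A)"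
  define H2 :: "(('a \<times> real) \<times> real) set" where
    "H2 = (\<lambda>(a, b). ((a, -b), b - a \<bullet> m)) ` B"
  \<comment> \<open>These are invariants of the derived inequalities. An element
    \<open>((c, g), r)\<close> carries the affine function \<open>c \<bullet> x + g\<close>,
    nonpositive on \<open>P\<close> for \<open>C1\<close> and on \<open>Q\<close> for
    \<open>C2\<close>, together with what has to be remembered about the right-hand side
    \<open>r\<close>.\<close>
  define C1 :: "(('a \<times> real) \<times> real) set" where
    "C1 = {p. snd p = 0 \<and> (\<forall>x\<in>P. fst (fst p) \<bullet> x + snd (fst p) \<le> 0)}"
  define C2 :: "(('a \<times> real) \<times> real) set" where
    "C2 = {p. snd p + snd (fst p) + fst (fst p) \<bullet> m \<ge> 0 \<and> (\<forall>x\<in>Q. fst (fst p) \<bullet> x + snd (fst p) \<le> 0)}"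
  have scale_le: "k * u + k * g \<le> 0" if "k \<ge> 0" "u + g \<le> 0" for k u g :: real
    using mult_nonneg_nonpos[OF that] by (simp add: distrib_left)
  have sum_le: "u + u' + (g + g') \<le> 0" if "u + g \<le> 0" "u' + g' \<le> 0" for u u' g g' :: real
    using that by linarith
  have "convex_cone C1"
    unfolding convex_cone_iff by (auto simp: C1_def inner_add_left intro: scale_le sum_le)
  moreover have "H1 \<subseteq> C1" by (auto simp: H1_def C1_def A)
  ultimately have 1: "convex_cone hull H1 \<subseteq> C1" by (simp add: hull_minimal)
  have "k * r + k * g + k * u \<ge> 0" if "k \<ge> 0" "r + g + u \<ge> 0" for k r g u :: real
    using mult_nonneg_nonneg[OF that] by (simp add: distrib_left)
  moreover have "r + r' + (g + g') + (u + u') \<ge> 0" if "r + g + u \<ge> 0" "r' + g' + u' \<ge> 0"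
    for r r' g g' u u' :: real
    using that by linarith
  ultimately have "convex_cone C2"
    unfolding convex_cone_iff by (auto simp: C2_def inner_add_left intro: scale_le sum_le)
  moreover have "insert (0, 1) H2 \<subseteq> C2" by (auto simp: H2_def C2_def B zero_prod_def)
  ultimately have 2: "convex_cone hull (insert (0, 1) H2) \<subseteq> C2" by (simp add: hull_minimal)
  show ?thesis
  proof (cases "(0, -1) \<in> convex_cone hull (insert (0, 1) (H1 \<union> H2))")
    case True
    then have "(0, -1) \<in> convex_cone hull (H1 \<union> insert (0, 1) H2)" by simp
    then obtain p1 p2 where p: "p1 \<in> C1" "p2 \<in> C2" "(0, -1) = p1 + p2"
      unfolding convex_cone_hull_Un using 1 2 by blast
    obtain c g r where p1: "p1 = ((c, g), r)" by (metis surj_pair)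
    obtain c' g' r' where p2: "p2 = ((c', g'), r')" by (metis surj_pair)
    \<comment> \<open>The two parts carry opposite affine functions, which is the separation. Since
      \<open>r = 0\<close> in \<open>C1\<close>, the whole of \<open>-1\<close> falls on the second
      part and gives \<open>c \<bullet> m \<le> - g - 1\<close>; this is the source of strictness at
      \<open>m\<close>.\<close>
    have eq: "c' = - c" "g' = - g" "r + r' = -1"
      using p(3) unfolding p1 p2 by (auto simp: zero_prod_def eq_neg_iff_add_eq_0 add.commute)
    have "(\<forall>x\<in>P. c \<bullet> x \<le> - g) \<and> (\<forall>y\<in>Q. - g \<le> c \<bullet> y) \<and> c \<bullet> m < - g"
      using p(1,2) eq unfolding p1 p2 C1_def C2_def by (force simp: algebra_simps)
    then show ?thesis by blast
  next
    case False
    then obtain z where z: "\<forall>(v, r)\<in>H1 \<union> H2. v \<bullet> z \<le> r"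
      using finite_system_feasible[of "H1 \<union> H2"] A(1) B(1) by (auto simp: H1_def H2_def)
    obtain x s where xs: "z = (x, s)" by fastforce
    have s: "s \<ge> 0" using z by (auto simp: H1_def xs)
    have x: "a \<bullet> x \<le> b * s" if "(a, b) \<in> A" for a b
      using z that unfolding H1_def xs by force
    have xm: "a \<bullet> (x + m) \<le> b * (s + 1)" if "(a, b) \<in> B" for a b
      using z that unfolding H2_def xs by (force simp: algebra_simps)
    define l where "l = 1 / (s + 1)"
    have l: "l > 0" "l * (s + 1) = 1" using s by (auto simp: l_def)
    have scale: "a \<bullet> (l *\<^sub>R y) \<le> b" if "a \<bullet> y \<le> b * (s + 1)" for a y b
    proof -
      have "l * (a \<bullet> y) \<le> l * (b * (s + 1))" using that l(1) by (simp add: mult_left_mono)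
      also have "\<dots> = b" using l(2) by (metis mult.left_commute mult.right_neutral)
      finally show ?thesis by simp
    qed
    have "l *\<^sub>R (x + m) \<in> Q" using scale xm unfolding B by blast
    moreover have "l *\<^sub>R (x + m) + l *\<^sub>R v \<in> P" if "m + v \<in> P" for v
    proof -
      have "a \<bullet> (x + m + v) \<le> b * (s + 1)" if "(a, b) \<in> A" for a b
      proof -
        have "a \<bullet> (m + v) \<le> b" using \<open>m + v \<in> P\<close> that unfolding A by auto
        then show ?thesis using x[OF that] by (simp add: algebra_simps)
      qed
      then show ?thesis using scale[of _ "x + m + v"] unfolding A scaleR_add_right[symmetric] by blast
    qed
    ultimately show ?thesis using l(1) by blast
  qed
qed

section \<open>Maximal families of disjoint convex cells\<close>

locale maximal_cells =
  fixes I :: "'i set" and U :: "'i \<Rightarrow> 'v::euclidean_space set"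
  assumes finite_I: "finite I"
    and open_U: "i \<in> I \<Longrightarrow> open (U i)"
    and convex_U: "i \<in> I \<Longrightarrow> convex (U i)"
    and nonempty_U: "i \<in> I \<Longrightarrow> U i \<noteq> {}"
    and disjoint_U: "i \<in> I \<Longrightarrow> k \<in> I \<Longrightarrow> i \<noteq> k \<Longrightarrow> U i \<inter> U k = {}"
    and maximal_U: "i \<in> I \<Longrightarrow> open V \<Longrightarrow> convex V \<Longrightarrow> U i \<subseteq> V \<Longrightarrow>
          (\<And>k. k \<in> I \<Longrightarrow> k \<noteq> i \<Longrightarrow> V \<inter> U k = {}) \<Longrightarrow> V = U i"
begin

lemma separating_functional:
  assumes "i \<in> I" "k \<in> I" "i \<noteq> k"
  shows "\<exists>c \<beta>. c \<noteq> 0 \<and> (\<forall>x\<in>closure (U i). c \<bullet> x \<le> \<beta>) \<and> (\<forall>y\<in>closure (U k). \<beta> \<le> c \<bullet> y)"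
proof -
  obtain c \<beta> where c: "c \<noteq> 0" "\<forall>x\<in>U i. c \<bullet> x \<le> \<beta>" "\<forall>y\<in>U k. \<beta> \<le> c \<bullet> y"
    using separating_hyperplane_sets[of "U i" "U k"] convex_U nonempty_U disjoint_U assms by blast
  then have "U i \<subseteq> {x. c \<bullet> x \<le> \<beta>}" "U k \<subseteq> {x. \<beta> \<le> c \<bullet> x}" by auto
  then have "closure (U i) \<subseteq> {x. c \<bullet> x \<le> \<beta>}" "closure (U k) \<subseteq> {x. \<beta> \<le> c \<bullet> x}"
    by (simp_all add: closure_minimal closed_halfspace_le closed_halfspace_ge)
  then show ?thesis using c(1) by blast
qed

lemma less_on_cell:
  assumes "i \<in> I" "c \<noteq> 0" "\<forall>x\<in>closure (U i). c \<bullet> x \<le> \<beta>" "x \<in> U i"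
  shows "c \<bullet> x < \<beta>"
proof -
  have "U i \<subseteq> {x. c \<bullet> x \<le> \<beta>}" using assms(3) closure_subset by blast
  then have "U i \<subseteq> interior {x. c \<bullet> x \<le> \<beta>}" using open_U[OF assms(1)] by (simp add: interior_maximal)
  then show ?thesis using assms(2,4) by auto
qed

lemma greater_on_cell:
  assumes "k \<in> I" "c \<noteq> 0" "\<forall>x\<in>closure (U k). \<beta> \<le> c \<bullet> x" "x \<in> U k"
  shows "\<beta> < c \<bullet> x"
  using less_on_cell[of k "-c" "-\<beta>" x] assms by simp

lemma interior_closure_cell: "i \<in> I \<Longrightarrow> interior (closure (U i)) = U i"
  by (simp add: convex_interior_closure convex_U interior_open open_U)

text \<open>Maximality speaks of open sets only, so it is applied to the interior of the
  intersection \<open>Q\<close> of one separating halfspace per other cell; \<open>Q\<close> is then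
  recovered as the closure of its interior.\<close>

lemma polyhedron_closure_cell:
  assumes i: "i \<in> I"
  shows "polyhedron (closure (U i))"
proof -
  have "\<forall>k\<in>I - {i}. \<exists>p. fst p \<noteq> 0 \<and> (\<forall>x\<in>closure (U i). fst p \<bullet> x \<le> snd p) \<and>
          (\<forall>y\<in>closure (U k). snd p \<le> fst p \<bullet> y)"
    using separating_functional[OF i] by simp blast
  from bchoice[OF this] obtain p where p: "\<And>k. k \<in> I - {i} \<Longrightarrow> fst (p k) \<noteq> 0"
    "\<And>k x. k \<in> I - {i} \<Longrightarrow> x \<in> closure (U i) \<Longrightarrow> fst (p k) \<bullet> x \<le> snd (p k)"
    "\<And>k x. k \<in> I - {i} \<Longrightarrow> x \<in> closure (U k) \<Longrightarrow> snd (p k) \<le> fst (p k) \<bullet> x" by blast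
  define Q where "Q = (\<Inter>k\<in>I - {i}. {x. fst (p k) \<bullet> x \<le> snd (p k)})"
  have Q: "polyhedron Q"
    unfolding Q_def using finite_I by (auto simp: polyhedron_halfspace_le)
  have UQ: "U i \<subseteq> Q" using p(2) closure_subset by (fastforce simp: Q_def)
  have "interior Q = U i"
  proof (rule maximal_U[OF i])
    show "open (interior Q)" "convex (interior Q)"
      using Q by (auto simp: polyhedron_imp_convex)
    show "U i \<subseteq> interior Q" using UQ open_U[OF i] by (simp add: interior_maximal)
    fix k assume k: "k \<in> I" "k \<noteq> i"
    show "interior Q \<inter> U k = {}"
    proof (rule equals0I)
      fix x assume "x \<in> interior Q \<inter> U k"
      then have "fst (p k) \<bullet> x \<le> snd (p k)" "snd (p k) < fst (p k) \<bullet> x"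
        using interior_subset[of Q] k p(1,3)[of k] greater_on_cell[OF k(1)] by (auto simp: Q_def)
      then show False by linarith
    qed
  qed
  then have "closure (U i) = closure Q"
    using convex_closure_interior[of Q] Q nonempty_U[OF i] by (simp add: polyhedron_imp_convex)
  then show ?thesis using Q by (simp add: polyhedron_imp_closed)
qed

text \<open>The condition on \<open>l\<close> says that \<open>q\<close> is at least as deep inside the cell \<open>i\<close> as \<open>m\<close>: a supporting
  hyperplane of the cell through \<open>q\<close> also passes through \<open>m\<close>.\<close>

definition touch :: "'i \<Rightarrow> 'v \<Rightarrow> 'i \<Rightarrow> 'v \<Rightarrow> bool" where
  "touch i m k q \<longleftrightarrow> k \<in> I \<and> k \<noteq> i \<and> q \<in> closure (U k) \<and>
     (\<exists>l>0. \<forall>v. m + v \<in> closure (U i) \<longrightarrow> q + l *\<^sub>R v \<in> closure (U i))"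

lemma touch_exists:
  assumes i: "i \<in> I" and m: "m \<in> closure (U i)" "m \<notin> U i"
  shows "\<exists>k q. touch i m k q"
proof (rule ccontr)
  assume no: "\<nexists>k q. touch i m k q"
  have "\<exists>p. fst p \<noteq> 0 \<and> (\<forall>x\<in>closure (U i). fst p \<bullet> x \<le> snd p) \<and>
          (\<forall>y\<in>closure (U k). snd p \<le> fst p \<bullet> y) \<and> fst p \<bullet> m < snd p" if k: "k \<in> I - {i}" for k
  proof -
    have "\<not> (\<exists>q\<in>closure (U k). \<exists>l>0. \<forall>v. m + v \<in> closure (U i) \<longrightarrow> q + l *\<^sub>R v \<in> closure (U i))"
      using no k unfolding touch_def by blast
    then obtain c \<beta> where c: "\<forall>x\<in>closure (U i). c \<bullet> x \<le> \<beta>" "\<forall>y\<in>closure (U k). \<beta> \<le> c \<bullet> y" "c \<bullet> m < \<beta>"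
      using separation_or_contact[of "closure (U i)" "closure (U k)" m] polyhedron_closure_cell i k m by blast
    moreover have "c \<noteq> 0"
      using c(2,3) nonempty_U[of k] k by (metis DiffD1 closure_eq_empty equals0I inner_zero_left not_le)
    ultimately show ?thesis by (intro exI[of _ "(c, \<beta>)"]) simp
  qed
  then have "\<forall>k\<in>I - {i}. \<exists>p. fst p \<noteq> 0 \<and> (\<forall>x\<in>closure (U i). fst p \<bullet> x \<le> snd p) \<and>
          (\<forall>y\<in>closure (U k). snd p \<le> fst p \<bullet> y) \<and> fst p \<bullet> m < snd p" by blast
  from bchoice[OF this] obtain p where p: "\<And>k. k \<in> I - {i} \<Longrightarrow> fst (p k) \<noteq> 0"
    "\<And>k. k \<in> I - {i} \<Longrightarrow> \<forall>x \<in> closure (U i). fst (p k) \<bullet> x \<le> snd (p k)"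
    "\<And>k. k \<in> I - {i} \<Longrightarrow> \<forall>x \<in> closure (U k). snd (p k) \<le> fst (p k) \<bullet> x"
    "\<And>k. k \<in> I - {i} \<Longrightarrow> fst (p k) \<bullet> m < snd (p k)" by blast
  \<comment> \<open>The inequalities are strict to make \<open>V\<close> open. The point
    \<open>m\<close> satisfies all of them by the choice of the separations, so maximality would put
    it into \<open>U i\<close>.\<close>
  define V where "V = (\<Inter>k\<in>I - {i}. {x. fst (p k) \<bullet> x < snd (p k)})"
  have "V = U i"
  proof (rule maximal_U[OF i])
    show "open V" unfolding V_def using finite_I by (auto simp: open_halfspace_lt)
    show "convex V" unfolding V_def by (auto intro: convex_INT simp: convex_halfspace_lt)
    show "U i \<subseteq> V" using less_on_cell[OF i p(1,2)] by (auto simp: V_def)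
    fix k assume k: "k \<in> I" "k \<noteq> i"
    show "V \<inter> U k = {}"
    proof (rule equals0I)
      fix x assume x: "x \<in> V \<inter> U k"
      then have "x \<in> closure (U k)" using closure_subset by blast
      then have "snd (p k) \<le> fst (p k) \<bullet> x" using p(3)[of k] k by blast
      moreover have "fst (p k) \<bullet> x < snd (p k)" using x k unfolding V_def by blast
      ultimately show False by linarith
    qed
  qed
  then show False using m p(4) by (auto simp: V_def)
qed

text \<open>The choice \<open>v = q - m\<close> prolongs the segment from \<open>m\<close> to
  \<open>q\<close> beyond \<open>q\<close> within the cell. As \<open>q\<close> lies in both
  closures, \<open>c\<close> attains its maximum \<open>\<beta>\<close> over the cell there, so it
  cannot be smaller at \<open>m\<close>.\<close>

lemma touch_separation:
  assumes "touch i m k q" "m \<in> closure (U i)"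
    and c: "\<forall>x\<in>closure (U i). c \<bullet> x \<le> \<beta>" "\<forall>y\<in>closure (U k). \<beta> \<le> c \<bullet> y"
  shows "c \<bullet> m = \<beta>"
proof -
  obtain l where l: "l > 0" "\<And>v. m + v \<in> closure (U i) \<Longrightarrow> q + l *\<^sub>R v \<in> closure (U i)"
    and q: "q \<in> closure (U k)" using assms(1) unfolding touch_def by blast
  have qi: "q \<in> closure (U i)" using l(2)[of 0] assms(2) by simp
  then have "q + l *\<^sub>R (q - m) \<in> closure (U i)" using l(2)[of "q - m"] by simp
  then have "c \<bullet> (q + l *\<^sub>R (q - m)) \<le> \<beta>" using c(1) by blast
  moreover have "c \<bullet> q = \<beta>" using c q qi by (metis antisym)
  ultimately have "l * (\<beta> - c \<bullet> m) \<le> 0" by (simp add: inner_add_right inner_diff_right)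
  then have "\<beta> \<le> c \<bullet> m" using l(1) by (simp add: mult_le_0_iff)
  then show ?thesis using c(1) assms(2) by (simp add: antisym)
qed

text \<open>The section is a face through the relatively interior point \<open>m\<close> of
  \<open>F\<close>, hence contains \<open>F\<close>. If it were larger, the two strict increases of
  dimension from \<open>F\<close> to the section and on to the cell would exceed the dimension of
  the space.\<close>

lemma facet_eq_hyperplane_section:
  assumes i: "i \<in> I" and F: "F face_of closure (U i)" "aff_dim F = int (DIM('v)) - 1"
    and m: "m \<in> rel_interior F" and t: "touch i m k q"
    and c: "c \<noteq> 0" "\<forall>x\<in>closure (U i). c \<bullet> x \<le> \<beta>" "\<forall>y\<in>closure (U k). \<beta> \<le> c \<bullet> y"
  shows "F = closure (U i) \<inter> {x. c \<bullet> x = \<beta>}"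
proof (rule ccontr)
  let ?P = "closure (U i)" and ?G = "closure (U i) \<inter> {x. c \<bullet> x = \<beta>}"
  assume "F \<noteq> ?G"
  have conv: "convex ?P" using convex_U[OF i] by (rule convex_closure)
  have FP: "F \<subseteq> ?P" using F(1) by (rule face_of_imp_subset)
  then have mP: "m \<in> ?P" using m rel_interior_subset by blast
  have G: "?G face_of ?P" using face_of_Int_supporting_hyperplane_le[OF conv] c(2) by blast
  have "c \<bullet> m = \<beta>" using touch_separation[OF t mP c(2,3)] .
  then have "F \<subseteq> ?G" using m mP by (intro subset_of_face_of[OF G FP]) auto
  then have "F face_of ?G" using face_of_subset[OF F(1)] by blast
  then have "aff_dim F < aff_dim ?G"
    using \<open>F \<noteq> ?G\<close> G by (meson face_of_aff_dim_lt face_of_imp_convex)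
  moreover have "?G \<noteq> ?P"
  proof -
    obtain x where x: "x \<in> U i" using nonempty_U[OF i] by blast
    then have "c \<bullet> x < \<beta>" using less_on_cell[OF i c(1,2)] by blast
    then show ?thesis using x closure_subset[of "U i"] by auto
  qed
  then have "aff_dim ?G < aff_dim ?P" using face_of_aff_dim_lt[OF conv G] by blast
  ultimately show False using F(2) aff_dim_le_DIM[of ?P] by linarith
qed

lemma touched_facet_unique:
  assumes "i \<in> I"
    and "F face_of closure (U i)" "aff_dim F = int (DIM('v)) - 1" "m \<in> rel_interior F" "touch i m k q"
    and "F' face_of closure (U i)" "aff_dim F' = int (DIM('v)) - 1" "m' \<in> rel_interior F'" "touch i m' k q'"
  shows "F = F'"
proof -
  have "k \<in> I" "k \<noteq> i" using assms(5) by (auto simp: touch_def)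
  then obtain c \<beta> where "c \<noteq> 0" "\<forall>x\<in>closure (U i). c \<bullet> x \<le> \<beta>" "\<forall>y\<in>closure (U k). \<beta> \<le> c \<bullet> y"
    using separating_functional[OF assms(1)] by metis
  then show ?thesis
    using facet_eq_hyperplane_section[OF assms(1-5)] facet_eq_hyperplane_section[OF assms(1,6-9)] by blast
qed

end

text \<open>A family is encoded as its graph in \<open>I \<times> UNIV\<close>, so that enlarging
  cells is inclusion and chains are bounded by their unions. Replacing a single section of a maximal
  graph then gives maximality of each cell separately.\<close>

lemma maximal_cells_exist:
  fixes U0 :: "'i \<Rightarrow> 'v::euclidean_space set"
  assumes "finite I" "\<And>i. i \<in> I \<Longrightarrow> open (U0 i)" "\<And>i. i \<in> I \<Longrightarrow> convex (U0 i)"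
    "\<And>i. i \<in> I \<Longrightarrow> U0 i \<noteq> {}" "disjoint_family_on U0 I"
  shows "\<exists>U. maximal_cells I U \<and> (\<forall>i\<in>I. U0 i \<subseteq> U i)"
proof -
  define \<A> where "\<A> = {G. G \<subseteq> I \<times> UNIV \<and>
    (\<forall>i\<in>I. open (G `` {i}) \<and> convex (G `` {i}) \<and> U0 i \<subseteq> G `` {i}) \<and>
    (\<forall>i\<in>I. \<forall>k\<in>I. i \<noteq> k \<longrightarrow> G `` {i} \<inter> G `` {k} = {})}"
  have "Sigma I U0 \<in> \<A>"
  proof -
    have "Sigma I U0 `` {i} = U0 i" if "i \<in> I" for i using that by auto
    then show ?thesis using assms by (auto simp: \<A>_def disjoint_family_on_def)
  qed
  then have "\<A> \<noteq> {}" by blast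
  moreover have "\<Union>\<C> \<in> \<A>" if \<C>: "\<C> \<noteq> {}" "subset.chain \<A> \<C>" for \<C>
  proof -
    have sub: "\<C> \<subseteq> \<A>" and chain: "\<And>G H. G \<in> \<C> \<Longrightarrow> H \<in> \<C> \<Longrightarrow> G \<subseteq> H \<or> H \<subseteq> G"
      using \<C>(2) by (auto simp: subset_chain_def)
    have im: "\<Union>\<C> `` {i} = (\<Union>G\<in>\<C>. G `` {i})" for i by blast
    have cv: "convex (\<Union>\<C> `` {i})" if "i \<in> I" for i
      unfolding convex_contains_segment
    proof (intro ballI)
      fix x y assume "x \<in> \<Union>\<C> `` {i}" "y \<in> \<Union>\<C> `` {i}"
      then obtain G where "G \<in> \<C>" "x \<in> G `` {i}" "y \<in> G `` {i}" using chain by blast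
      moreover have "convex (G `` {i})" using \<open>G \<in> \<C>\<close> sub that by (auto simp: \<A>_def)
      ultimately show "closed_segment x y \<subseteq> \<Union>\<C> `` {i}"
        unfolding im by (meson UN_upper convex_contains_segment order_trans)
    qed
    have op: "open (\<Union>\<C> `` {i})" if "i \<in> I" for i
      unfolding im using sub that by (intro open_UN) (auto simp: \<A>_def)
    have dj: "\<Union>\<C> `` {i} \<inter> \<Union>\<C> `` {k} = {}" if "i \<in> I" "k \<in> I" "i \<noteq> k" for i k
    proof (rule equals0I)
      fix x assume "x \<in> \<Union>\<C> `` {i} \<inter> \<Union>\<C> `` {k}"
      then obtain G where "G \<in> \<C>" "x \<in> G `` {i} \<inter> G `` {k}" using chain by blast
      moreover have "G `` {i} \<inter> G `` {k} = {}"
        using \<open>G \<in> \<C>\<close> sub that unfolding \<A>_def by blast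
      ultimately show False by blast
    qed
    have "U0 i \<subseteq> \<Union>\<C> `` {i}" if "i \<in> I" for i
      using \<C>(1) sub that by (fastforce simp: \<A>_def)
    moreover have "\<Union>\<C> \<subseteq> I \<times> UNIV" using sub by (auto simp: \<A>_def)
    ultimately show ?thesis using cv op dj
      unfolding \<A>_def mem_Collect_eq by (intro conjI ballI impI) assumption+
  qed
  ultimately obtain M where M: "M \<in> \<A>" "\<And>X. X \<in> \<A> \<Longrightarrow> M \<subseteq> X \<Longrightarrow> X = M"
    using subset_Zorn_nonempty[of \<A>] by blast
  define U where "U i = M `` {i}" for i
  have MU: "open (U i)" "convex (U i)" "U0 i \<subseteq> U i" if "i \<in> I" for i
    using M(1) that by (auto simp: \<A>_def U_def)
  have MD: "U i \<inter> U k = {}" if "i \<in> I" "k \<in> I" "i \<noteq> k" for i k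
    using M(1) that unfolding \<A>_def U_def by blast
  have MI: "M \<subseteq> I \<times> UNIV" using M(1) by (simp add: \<A>_def)
  have "maximal_cells I U"
  proof
    show "finite I" by fact
    show "open (U i)" "convex (U i)" if "i \<in> I" for i using MU[OF that] by blast+
    show "U i \<noteq> {}" if "i \<in> I" for i using MU(3)[OF that] assms(4)[OF that] by blast
    show "U i \<inter> U k = {}" if "i \<in> I" "k \<in> I" "i \<noteq> k" for i k using MD[OF that] .
    fix i V assume i: "i \<in> I" and V: "open V" "convex V" "U i \<subseteq> V"
      "\<And>k. k \<in> I \<Longrightarrow> k \<noteq> i \<Longrightarrow> V \<inter> U k = {}"
    let ?X = "M \<union> {i} \<times> V"
    have im: "?X `` {k} = (if k = i then V else U k)" for k using V(3) by (auto simp: U_def)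
    have "?X \<in> \<A>"
      unfolding \<A>_def mem_Collect_eq im
    proof (intro conjI ballI impI)
      show "?X \<subseteq> I \<times> UNIV" using MI i by blast
      fix k assume k: "k \<in> I"
      show "open (if k = i then V else U k)" "convex (if k = i then V else U k)"
        "U0 k \<subseteq> (if k = i then V else U k)" using MU[OF k] V by auto
      fix k' assume "k' \<in> I" "k \<noteq> k'"
      then show "(if k = i then V else U k) \<inter> (if k' = i then V else U k') = {}"
        using V(4) MD k by (auto simp: Int_commute)
    qed
    then have "?X = M" using M(2) by blast
    then show "V = U i" using im[of i] by (simp add: U_def)
  qed
  then show ?thesis using MU(3) by blast
qed

section \<open>Slicing the cells\<close>

text \<open>\<open>u\<close> gives the coordinate along which the cutting lines move,
  \<open>w\<close> their direction. Dimension two enters through \<open>vertical\<close>. Keeping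
  \<open>w\<close> a parameter allows the locale to be interpreted with \<open>- w\<close> as
  well.\<close>

locale sliced_cells = maximal_cells I U for I :: "'i set" and U :: "'i \<Rightarrow> 'v::euclidean_space set" +
  fixes u w :: 'v
  assumes u_nonzero: "u \<noteq> 0" and w_nonzero: "w \<noteq> 0"
    and u_orthogonal_w: "u \<bullet> w = 0"
    and vertical: "u \<bullet> p = 0 \<Longrightarrow> \<exists>t. p = t *\<^sub>R w"
begin

definition below :: "'i \<Rightarrow> 'i \<Rightarrow> bool" where
  "below i k \<longleftrightarrow> i \<noteq> k \<and> (\<exists>p\<in>U i. \<exists>t>0. p + t *\<^sub>R w \<in> U k)"

definition slice :: "real \<Rightarrow> 'i set" where
  "slice x = {i \<in> I. \<exists>p\<in>U i. u \<bullet> p = x}"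

lemma finite_slice: "finite (slice x)"
  using finite_I by (simp add: slice_def)

text \<open>The one vertical pair witnessing \<open>below\<close> fixes the sign of
  \<open>c \<bullet> w\<close> for a separating functional \<open>c\<close>; this sign then governs
  all vertical pairs, including those of boundary points.\<close>

lemma below_nonneg:
  assumes ik: "i \<in> I" "k \<in> I" and b: "below i k"
    and p: "p \<in> closure (U i)" "p + t *\<^sub>R w \<in> closure (U k)"
  shows "t \<ge> 0"
proof -
  obtain p' t' where p': "i \<noteq> k" "p' \<in> U i" "t' > 0" "p' + t' *\<^sub>R w \<in> U k"
    using b unfolding below_def by blast
  obtain c \<beta> where c: "c \<noteq> 0" "\<forall>x\<in>closure (U i). c \<bullet> x \<le> \<beta>" "\<forall>y\<in>closure (U k). \<beta> \<le> c \<bullet> y"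
    using separating_functional[OF ik p'(1)] by blast
  have "c \<bullet> p' < c \<bullet> (p' + t' *\<^sub>R w)"
    using less_on_cell[OF ik(1) c(1,2) p'(2)] greater_on_cell[OF ik(2) c(1,3) p'(4)] by linarith
  then have cw: "c \<bullet> w > 0" using p'(3) by (simp add: inner_add_right zero_less_mult_iff)
  have "c \<bullet> p \<le> c \<bullet> (p + t *\<^sub>R w)" using c(2,3) p by (meson order_trans)
  then show ?thesis using cw by (simp add: inner_add_right zero_le_mult_iff)
qed

lemma below_iff:
  assumes ik: "i \<in> I" "k \<in> I" "i \<noteq> k" and p: "p \<in> U i" "q \<in> U k" "u \<bullet> p = u \<bullet> q"
  shows "below i k \<longleftrightarrow> w \<bullet> p < w \<bullet> q"
proof -
  obtain t where t: "q - p = t *\<^sub>R w"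
    using vertical[of "q - p"] p(3) by (auto simp: inner_diff_right)
  then have q: "q = p + t *\<^sub>R w" by (simp add: algebra_simps)
  have "p \<noteq> q" using disjoint_U[OF ik] p by blast
  then have "t \<noteq> 0" using q by auto
  have "w \<bullet> p < w \<bullet> q \<longleftrightarrow> 0 < t * (w \<bullet> w)" by (simp add: q inner_add_right)
  also have "\<dots> \<longleftrightarrow> t > 0"
    using w_nonzero by (metis inner_gt_zero_iff mult_pos_pos zero_less_mult_pos2)
  finally have "w \<bullet> p < w \<bullet> q \<longleftrightarrow> t > 0" .
  moreover have "below i k \<longleftrightarrow> t > 0"
  proof
    show "t > 0 \<Longrightarrow> below i k" using ik(3) p q unfolding below_def by blast
    assume "below i k"
    then have "t \<ge> 0"
      using below_nonneg[OF ik(1,2), of p t] p q closure_subset by blast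
    then show "t > 0" using \<open>t \<noteq> 0\<close> by simp
  qed
  ultimately show ?thesis by simp
qed

lemma lin_on_slice: "lin_on below (slice x)"
proof -
  have "\<forall>i\<in>slice x. \<exists>p. p \<in> U i \<and> u \<bullet> p = x" by (auto simp: slice_def)
  from bchoice[OF this] obtain p where p: "\<And>i. i \<in> slice x \<Longrightarrow> p i \<in> U i \<and> u \<bullet> p i = x" by blast
  have I: "i \<in> I" if "i \<in> slice x" for i using that by (simp add: slice_def)
  have "i = k" if ik: "i \<in> slice x" "k \<in> slice x" "w \<bullet> p i = w \<bullet> p k" for i k
  proof (rule ccontr)
    assume "i \<noteq> k"
    obtain t where t: "p k - p i = t *\<^sub>R w"
      using vertical[of "p k - p i"] p ik by (auto simp: inner_diff_right)
    have "w \<bullet> (p k - p i) = 0" using ik by (simp add: inner_diff_right)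
    then have "p k = p i" using t w_nonzero by simp
    then show False using disjoint_U[of i k] I p ik \<open>i \<noteq> k\<close> by (metis IntI empty_iff)
  qed
  moreover have "below i k \<longleftrightarrow> w \<bullet> p i < w \<bullet> p k" if ik: "i \<in> slice x" "k \<in> slice x" for i k
  proof (cases "i = k")
    case False
    then show ?thesis using below_iff[of i k "p i" "p k"] I p ik by simp
  qed (simp add: below_def)
  ultimately show ?thesis
    unfolding lin_on_def inj_on_def by (intro exI[of _ "\<lambda>i. w \<bullet> p i"]) simp
qed

lemma convex_shadow: "i \<in> I \<Longrightarrow> convex ((\<bullet>) u ` U i)"
  by (intro convex_linear_image convex_U bounded_linear.linear bounded_linear_inner_right)

lemma slice_convex:
  assumes "x \<le> y" "y \<le> z"
  shows "slice x \<inter> slice z \<subseteq> slice y"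
proof
  fix i assume i: "i \<in> slice x \<inter> slice z"
  then have "i \<in> I" "x \<in> (\<bullet>) u ` U i" "z \<in> (\<bullet>) u ` U i" by (auto simp: slice_def)
  then have "y \<in> (\<bullet>) u ` U i"
    using convex_shadow[of i] assms by (meson is_interval_convex_1 mem_is_interval_1_I)
  then show "i \<in> slice y" using \<open>i \<in> I\<close> by (auto simp: slice_def)
qed

text \<open>Both \<open>q + e\<close> and \<open>q - e\<close> project into the closure of the
  shadow of the cell, and the shadow, being convex, contains the interior of its closure. So all
  lines strictly between these projections meet the open cell, even if \<open>q\<close> is a
  boundary point.\<close>

lemma mem_slice:
  assumes i: "i \<in> I" and e: "q + e \<in> closure (U i)" "q - e \<in> closure (U i)"
    and s: "\<bar>s\<bar> < 1" "u \<bullet> e \<noteq> 0"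
  shows "i \<in> slice (u \<bullet> q + s * (u \<bullet> e))"
proof -
  let ?J = "(\<bullet>) u ` U i"
  have J: "convex ?J" using convex_shadow[OF i] .
  have "(\<bullet>) u ` closure (U i) \<subseteq> closure ?J"
    by (intro image_closure_subset continuous_intros closure_subset closed_closure)
  then have "u \<bullet> (q + e) \<in> closure ?J" "u \<bullet> (q - e) \<in> closure ?J" using e by blast+
  then have ends: "u \<bullet> q + u \<bullet> e \<in> closure ?J" "u \<bullet> q - u \<bullet> e \<in> closure ?J"
    by (simp_all add: inner_add_right inner_diff_right)
  let ?a = "u \<bullet> q - \<bar>u \<bullet> e\<bar>" and ?b = "u \<bullet> q + \<bar>u \<bullet> e\<bar>"
  have ab: "?a \<in> closure ?J" "?b \<in> closure ?J" using ends by (auto simp: abs_if)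
  have "{?a<..<?b} \<subseteq> closure ?J"
    using ab convex_closure[OF J]
    by (meson greaterThanLessThan_iff is_interval_convex_1 less_imp_le mem_is_interval_1_I subsetI)
  then have "{?a<..<?b} \<subseteq> interior (closure ?J)" by (simp add: interior_maximal)
  moreover have "interior (closure ?J) \<subseteq> ?J"
    using convex_interior_closure[OF J] interior_subset by blast
  moreover have "u \<bullet> q + s * (u \<bullet> e) \<in> {?a<..<?b}"
  proof -
    have "\<bar>s * (u \<bullet> e)\<bar> < \<bar>u \<bullet> e\<bar>" using s by (simp add: abs_mult)
    then show ?thesis by auto
  qed
  ultimately have "u \<bullet> q + s * (u \<bullet> e) \<in> ?J" by blast
  then show ?thesis using i by (auto simp: slice_def)
qed

text \<open>The touching cell \<open>k\<close> itself need not be adjacent to \<open>i\<close>, but the cells that lie just below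
  \<open>i\<close> in slices close to \<open>q\<close> are squeezed between \<open>k\<close> and \<open>i\<close>, hence one of them contains \<open>q\<close> in
  its closure.\<close>

lemma touch_below_adjacent:
  assumes i: "i \<in> I" and t: "touch i m k q" and "below k i"
    and d: "m + d \<in> closure (U i)" "m - d \<in> closure (U i)" "u \<bullet> d \<noteq> 0"
    and m: "m \<in> closure (U i)"
  shows "\<exists>k' x. touch i m k' q \<and> (k', i) \<in> adj below (slice x)"
proof -
  obtain l where l: "l > 0" "\<And>v. m + v \<in> closure (U i) \<Longrightarrow> q + l *\<^sub>R v \<in> closure (U i)"
    and k: "k \<in> I" "k \<noteq> i" and qk: "q \<in> closure (U k)" using t unfolding touch_def by blast
  define e where "e = l *\<^sub>R d"
  have e: "q + e \<in> closure (U i)" "q - e \<in> closure (U i)"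
    using l(2)[of d] l(2)[of "- d"] d by (auto simp: e_def)
  have ue: "u \<bullet> e \<noteq> 0" using d l by (simp add: e_def)
  obtain p where p: "p \<in> U k"
    using nonempty_U k by blast
  \<comment> \<open>\<open>\<alpha>\<close> compares the projections of \<open>p - q\<close> and
    \<open>e\<close>, so that \<open>y n\<close> in cell \<open>k\<close> and \<open>z n\<close> on
    the segment in the closure of cell \<open>i\<close> lie on the same vertical line. The factor
    \<open>1 + \<bar>\<alpha>\<bar>\<close> in \<open>\<tau>\<close> keeps \<open>z n\<close> inside
    the segment; both sequences tend to \<open>q\<close>.\<close>
  define \<alpha> where "\<alpha> = u \<bullet> (p - q) / (u \<bullet> e)"
  define \<tau> where "\<tau> n = 1 / ((1 + \<bar>\<alpha>\<bar>) * real (Suc n))" for n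
  define y where "y n = q + \<tau> n *\<^sub>R (p - q)" for n
  define z where "z n = q + (\<tau> n * \<alpha>) *\<^sub>R e" for n
  define x where "x n = u \<bullet> q + (\<tau> n * \<alpha>) * (u \<bullet> e)" for n
  have \<tau>: "\<tau> n > 0" "\<tau> n \<le> 1 / real (Suc n)" "\<tau> n \<le> 1" "\<bar>\<tau> n * \<alpha>\<bar> < 1" for n
  proof -
    show pos: "\<tau> n > 0" by (simp add: \<tau>_def add_pos_nonneg)
    have "real (Suc n) \<le> (1 + \<bar>\<alpha>\<bar>) * real (Suc n)" by (simp add: mult_le_cancel_right1)
    then show le: "\<tau> n \<le> 1 / real (Suc n)" unfolding \<tau>_def by (intro divide_left_mono) auto
    also have "\<dots> \<le> 1" by simp
    finally show "\<tau> n \<le> 1" .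
    have "\<bar>\<alpha>\<bar> < (1 + \<bar>\<alpha>\<bar>) * real (Suc n)"
    proof -
      have "\<bar>\<alpha>\<bar> < (1 + \<bar>\<alpha>\<bar>) * 1" by simp
      also have "\<dots> \<le> (1 + \<bar>\<alpha>\<bar>) * real (Suc n)" by (intro mult_left_mono) auto
      finally show ?thesis .
    qed
    then have "\<bar>\<alpha>\<bar> / ((1 + \<bar>\<alpha>\<bar>) * real (Suc n)) < 1"
      by (subst pos_divide_less_eq) (auto simp: add_pos_nonneg)
    then show "\<bar>\<tau> n * \<alpha>\<bar> < 1" using pos by (simp add: abs_mult) (simp add: \<tau>_def)
  qed
  have uy: "u \<bullet> y n = x n" for n
    using ue by (simp add: y_def x_def \<alpha>_def inner_add_right)
  have uz: "u \<bullet> z n = x n" for n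
    by (simp add: z_def x_def inner_add_right)
  have yk: "y n \<in> U k" for n
  proof -
    have "q - \<tau> n *\<^sub>R (q - p) \<in> interior (U k)"
      using \<tau> p qk k by (intro mem_interior_closure_convex_shrink) (auto simp: convex_U open_U interior_open)
    moreover have "q - \<tau> n *\<^sub>R (q - p) = y n" by (simp add: y_def algebra_simps)
    ultimately show ?thesis using interior_subset by auto
  qed
  have zi: "z n \<in> closure (U i)" for n
  proof -
    define s where "s = (1 + \<tau> n * \<alpha>) / 2"
    have s: "0 \<le> s" "0 \<le> 1 - s" using \<tau>(4)[of n] by (auto simp: s_def)
    have "s *\<^sub>R (q + e) + (1 - s) *\<^sub>R (q - e) \<in> closure (U i)"
      using convex_closure[OF convex_U[OF i]] e s by (simp add: convexD)
    moreover have "s *\<^sub>R (q + e) + (1 - s) *\<^sub>R (q - e) = q + (2 * s - 1) *\<^sub>R e"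
      by (simp add: algebra_simps flip: scaleR_add_left)
    moreover have "2 * s - 1 = \<tau> n * \<alpha>" by (simp add: s_def field_simps)
    ultimately show ?thesis by (simp add: z_def)
  qed
  have slices: "i \<in> slice (x n)" "k \<in> slice (x n)" for n
    using mem_slice[OF i e \<tau>(4) ue] yk uy k by (auto simp: x_def[symmetric] slice_def)
  \<comment> \<open>The cell \<open>j\<close> next below \<open>i\<close> has a point
    \<open>y'\<close> on the line of \<open>y n\<close> and \<open>z n\<close>, and the order of the
    cells forces it between these two. Its distance from \<open>q\<close> is therefore at most of
    the order of \<open>\<tau> n\<close>.\<close>
  have "\<exists>j y'. (j, i) \<in> adj below (slice (x n)) \<and> y' \<in> U j \<and> dist y' q \<le> \<tau> n * (2 * norm (p - q) + \<bar>\<alpha>\<bar> * norm e)"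
    for n
  proof -
    obtain j where j: "(j, i) \<in> adj below (slice (x n))" "j = k \<or> below k j"
      using adj_below_exists[OF lin_on_slice finite_slice slices assms(3)] by blast
    then have jI: "j \<in> I" "below j i" by (auto simp: adj_def slice_def)
    have "\<exists>y'\<in>U j. \<exists>a\<ge>0. y' = y n + a *\<^sub>R w"
    proof (cases "j = k")
      case True
      then show ?thesis using yk[of n] by (intro bexI[of _ "y n"] exI[of _ 0]) auto
    next
      case False
      obtain y' where y': "y' \<in> U j" "u \<bullet> y' = x n" using j(1) by (auto simp: adj_def slice_def)
      obtain a where a: "y' - y n = a *\<^sub>R w"
        using vertical[of "y' - y n"] y'(2) uy by (auto simp: inner_diff_right)
      then have "y' = y n + a *\<^sub>R w" by (simp add: algebra_simps)
      moreover have "a \<ge> 0"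
        using below_nonneg[of k j "y n" a] False j(2) k jI yk y'(1) calculation closure_subset by blast
      ultimately show ?thesis using y'(1) by blast
    qed
    then obtain y' a where y': "y' \<in> U j" "a \<ge> 0" "y' = y n + a *\<^sub>R w" by blast
    have "u \<bullet> y' = x n" using y'(3) uy u_orthogonal_w by (simp add: inner_add_right)
    then obtain b where b: "z n - y' = b *\<^sub>R w"
      using vertical[of "z n - y'"] uz by (auto simp: inner_diff_right)
    then have zb: "z n = y' + b *\<^sub>R w" by (simp add: algebra_simps)
    have "b \<ge> 0"
      using below_nonneg[OF jI(1) i jI(2), of y' b] y'(1) zi[of n] zb closure_subset by auto
    have "norm (y' - y n) = a * norm w" using y' by simp
    also have "\<dots> \<le> (a + b) * norm w" using \<open>b \<ge> 0\<close> by (simp add: mult_right_mono)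
    also have "\<dots> = norm ((a + b) *\<^sub>R w)" using \<open>a \<ge> 0\<close> \<open>b \<ge> 0\<close> by simp
    also have "(a + b) *\<^sub>R w = (z n - q) - (y n - q)" using zb y'(3) by (simp add: algebra_simps)
    also have "norm \<dots> \<le> norm (z n - q) + norm (y n - q)" by (rule norm_triangle_ineq4)
    finally have "norm (y' - y n) \<le> norm (z n - q) + norm (y n - q)" .
    moreover have "norm (y' - q) \<le> norm (y' - y n) + norm (y n - q)"
      using norm_triangle_ineq[of "y' - y n" "y n - q"] by simp
    moreover have "norm (y n - q) = \<tau> n * norm (p - q)" "norm (z n - q) = \<tau> n * (\<bar>\<alpha>\<bar> * norm e)"
      using \<tau>(1)[of n] by (simp_all add: y_def z_def abs_mult)
    ultimately have "dist y' q \<le> \<tau> n * (2 * norm (p - q) + \<bar>\<alpha>\<bar> * norm e)"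
      by (simp add: dist_norm algebra_simps)
    then show ?thesis using j(1) y'(1) by blast
  qed
  then obtain j y' where j: "\<And>n. (j n, i) \<in> adj below (slice (x n))"
    and y': "\<And>n. y' n \<in> U (j n)" "\<And>n. dist (y' n) q \<le> \<tau> n * (2 * norm (p - q) + \<bar>\<alpha>\<bar> * norm e)"
    by metis
  have jI: "j n \<in> I" "j n \<noteq> i" for n using j[of n] by (auto simp: adj_def slice_def below_def)
  have "finite (range j)" using finite_I jI(1) by (meson finite_subset image_subsetI)
  \<comment> \<open>Only finitely many cells are available, so one of them occurs for infinitely
    many \<open>n\<close>, and its points converge to \<open>q\<close>.\<close>
  then obtain n0 where inf: "infinite {n. j n = j n0}"
    using pigeonhole_infinite[of UNIV j] by auto
  have "q \<in> closure (U (j n0))"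
    unfolding closure_approachable
  proof (intro allI impI)
    fix \<epsilon> :: real assume "\<epsilon> > 0"
    define C where "C = 2 * norm (p - q) + \<bar>\<alpha>\<bar> * norm e"
    have "C \<ge> 0" by (simp add: C_def)
    obtain N where N: "C / \<epsilon> < real N" using reals_Archimedean2 by blast
    obtain n where n: "n \<ge> N" "j n = j n0" using inf unfolding infinite_nat_iff_unbounded_le by blast
    have "C < \<epsilon> * real N" using N \<open>\<epsilon> > 0\<close> by (simp add: pos_divide_less_eq mult.commute)
    also have "\<dots> \<le> \<epsilon> * real (Suc n)" using n(1) \<open>\<epsilon> > 0\<close> by (intro mult_left_mono) auto
    finally have "1 / real (Suc n) * C < \<epsilon>" by (simp add: pos_divide_less_eq)
    moreover have "\<tau> n * C \<le> 1 / real (Suc n) * C" using \<tau>(2) \<open>C \<ge> 0\<close> by (rule mult_right_mono)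
    ultimately have "dist (y' n) q < \<epsilon>" using y'(2)[of n] unfolding C_def by linarith
    then show "\<exists>y\<in>U (j n0). dist y q < \<epsilon>" using y'(1)[of n] n(2) by auto
  qed
  then have "touch i m (j n0) q" using jI l unfolding touch_def by blast
  then show ?thesis using j by blast
qed

text \<open>Here \<open>k\<close> may lie on either side of \<open>i\<close>. The case above reduces
  to the case below by reversing \<open>w\<close>, which reverses \<open>below\<close> and leaves
  the slices unchanged.\<close>

lemma touch_adjacent:
  assumes i: "i \<in> I" and t: "touch i m k q"
    and d: "m + d \<in> closure (U i)" "m - d \<in> closure (U i)" "u \<bullet> d \<noteq> 0"
    and m: "m \<in> closure (U i)"
  shows "\<exists>k' x. touch i m k' q \<and> ((k', i) \<in> adj below (slice x) \<or> (i, k') \<in> adj below (slice x))"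
proof -
  interpret neg: sliced_cells I U u "- w"
  proof
    show "u \<noteq> 0" "- w \<noteq> 0" "u \<bullet> - w = 0" using u_nonzero w_nonzero u_orthogonal_w by auto
    fix p assume "u \<bullet> p = 0"
    then obtain s where "p = s *\<^sub>R w" using vertical by blast
    then show "\<exists>s. p = s *\<^sub>R - w" by (intro exI[of _ "- s"]) simp
  qed
  have neg_below: "neg.below j k' \<longleftrightarrow> below k' j" for j k'
  proof -
    have "(\<exists>p\<in>U j. \<exists>s>0. p + s *\<^sub>R - w \<in> U k') \<longleftrightarrow> (\<exists>p\<in>U k'. \<exists>s>0. p + s *\<^sub>R w \<in> U j)" 
    proof
      assume "\<exists>p\<in>U j. \<exists>s>0. p + s *\<^sub>R - w \<in> U k'"
      then obtain p s where "p \<in> U j" "s > 0" "p + s *\<^sub>R - w \<in> U k'" by blast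
      then show "\<exists>p\<in>U k'. \<exists>s>0. p + s *\<^sub>R w \<in> U j"
        by (intro bexI[of _ "p + s *\<^sub>R - w"] exI[of _ s]) auto
    next
      assume "\<exists>p\<in>U k'. \<exists>s>0. p + s *\<^sub>R w \<in> U j"
      then obtain p s where "p \<in> U k'" "s > 0" "p + s *\<^sub>R w \<in> U j" by blast
      then show "\<exists>p\<in>U j. \<exists>s>0. p + s *\<^sub>R - w \<in> U k'"
        by (intro bexI[of _ "p + s *\<^sub>R w"] exI[of _ s]) auto
    qed
    then show ?thesis unfolding neg.below_def below_def by auto
  qed
  have neg_adj: "(k', i) \<in> adj neg.below S \<longleftrightarrow> (i, k') \<in> adj below S" for k' S
    by (auto simp: adj_def neg_below)
  obtain l where l: "l > 0" "\<And>v. m + v \<in> closure (U i) \<Longrightarrow> q + l *\<^sub>R v \<in> closure (U i)"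
    and k: "k \<in> I" "k \<noteq> i" and qk: "q \<in> closure (U k)" using t unfolding touch_def by blast
  have "below k i \<or> below i k"
  proof -
    have e: "q + l *\<^sub>R d \<in> closure (U i)" "q - l *\<^sub>R d \<in> closure (U i)" "u \<bullet> (l *\<^sub>R d) \<noteq> 0"
      using l(2)[of d] l(2)[of "- d"] d l(1) by auto
    \<comment> \<open>The strip \<open>?O\<close> around \<open>q\<close> is as wide as the
      projected segment, so every line in it meets cell \<open>i\<close>. As \<open>q\<close> is in
      the closure of cell \<open>k\<close>, one of these lines also meets \<open>k\<close>, which
      makes the two cells comparable.\<close>
    let ?b = "\<bar>u \<bullet> (l *\<^sub>R d)\<bar>"
    let ?O = "{v. u \<bullet> v < u \<bullet> q + ?b} \<inter> {v. u \<bullet> q - ?b < u \<bullet> v}"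
    have "open ?O" by (intro open_Int open_halfspace_lt open_halfspace_gt)
    moreover have "q \<in> ?O" using e(3) by auto
    ultimately have "?O \<inter> U k \<noteq> {}" using qk by (metis IntI empty_iff open_Int_closure_eq_empty)
    then obtain v where v: "v \<in> U k" "u \<bullet> v < u \<bullet> q + ?b" "u \<bullet> q - ?b < u \<bullet> v" by blast
    define s where "s = (u \<bullet> v - u \<bullet> q) / (u \<bullet> (l *\<^sub>R d))"
    have "\<bar>u \<bullet> v - u \<bullet> q\<bar> < ?b" using v by linarith
    then have "\<bar>s\<bar> < 1" using e(3) by (simp add: s_def abs_divide)
    then have "i \<in> slice (u \<bullet> q + s * (u \<bullet> (l *\<^sub>R d)))" using mem_slice[OF i e(1,2) _ e(3)] by blast
    then have "i \<in> slice (u \<bullet> v)" using e(3) by (simp add: s_def)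
    moreover have "k \<in> slice (u \<bullet> v)" using v k by (auto simp: slice_def)
    ultimately show ?thesis using lin_on_trichotomy[OF lin_on_slice] k(2) by blast
  qed
  then show ?thesis
  proof
    assume "below k i"
    then show ?thesis using touch_below_adjacent[OF i t _ d m] by blast
  next
    assume "below i k"
    then have "neg.below k i" by (simp add: neg_below)
    then obtain k' x where "touch i m k' q" "(k', i) \<in> adj neg.below (neg.slice x)"
      using neg.touch_below_adjacent[OF i t _ d m] by blast
    moreover have "neg.slice x = slice x" for x by (simp add: neg.slice_def slice_def)
    ultimately show ?thesis using neg_adj by metis
  qed
qed

end

section \<open>The plane\<close>

lemma generic_direction:
  fixes D :: "'a::euclidean_space set"
  assumes "finite D" "0 \<notin> D"
  shows "\<exists>u. \<forall>d\<in>D. u \<bullet> d \<noteq> 0"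
proof -
  have "negligible {x. d \<bullet> x = 0}" if "d \<in> D" for d
    using that assms(2) by (intro negligible_hyperplane) auto
  then have "negligible (\<Union>d\<in>D. {x. d \<bullet> x = 0})" using assms(1) by (intro negligible_Union) auto
  then have "(\<Union>d\<in>D. {x. d \<bullet> x = 0}) \<noteq> UNIV" using non_negligible_UNIV by metis
  then show ?thesis by (auto simp: inner_commute)
qed

lemma rel_interior_symmetric_segment:
  fixes F :: "'a::euclidean_space set"
  assumes "m \<in> rel_interior F" "aff_dim F \<ge> 1"
  shows "\<exists>d. d \<noteq> 0 \<and> m + d \<in> F \<and> m - d \<in> F"
proof -
  obtain e where e: "e > 0" "cball m e \<inter> affine hull F \<subseteq> F" and m: "m \<in> F"
    using assms(1) unfolding mem_rel_interior_cball by blast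
  have "F \<noteq> {m}" using assms(2) by auto
  then obtain a where a: "a \<in> F" "a \<noteq> m" using m by blast
  define s where "s = e / norm (a - m)"
  define d where "d = s *\<^sub>R (a - m)"
  have "s > 0" "norm d = e" using a(2) e(1) by (simp_all add: s_def d_def)
  moreover have "m + t *\<^sub>R (a - m) \<in> affine hull F" for t
    using mem_affine[OF affine_affine_hull, of m F a "1 - t" t] m a(1)
    by (simp add: hull_inc algebra_simps)
  from this[of s] this[of "- s"] have "m + d \<in> affine hull F" "m - d \<in> affine hull F"
    by (simp_all add: d_def)
  ultimately have "m + d \<in> F" "m - d \<in> F" using e by (auto simp: dist_norm)
  moreover have "d \<noteq> 0" using a(2) \<open>s > 0\<close> by (simp add: d_def)
  ultimately show ?thesis by blast
qed

lemma orthogonal_direction_plane: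
  fixes u p :: "real^2"
  assumes "u \<noteq> 0"
  defines "w \<equiv> vector [- u$2, u$1]"
  shows "w \<noteq> 0" "u \<bullet> w = 0" "u \<bullet> p = 0 \<Longrightarrow> \<exists>t. p = t *\<^sub>R w"
proof -
  show w: "w \<noteq> 0" using assms by (auto simp: vec_eq_iff forall_2)
  show "u \<bullet> w = 0" by (simp add: w_def inner_vec_def sum_2)
  assume "u \<bullet> p = 0"
  then have z: "u$1 * p$1 + u$2 * p$2 = 0" by (simp add: inner_vec_def sum_2)
  show "\<exists>t. p = t *\<^sub>R w"
  proof (cases "u$1 = 0")
    case True
    then have "u$2 \<noteq> 0" using assms(1) by (auto simp: vec_eq_iff forall_2)
    then have "p = (- p$1 / u$2) *\<^sub>R w" using z True by (simp add: vec_eq_iff forall_2 w_def)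
    then show ?thesis by blast
  next
    case False
    then have "p$1 = (p$2 / u$1) * (- u$2)" using z by (simp add: field_simps)
    then have "p = (p$2 / u$1) *\<^sub>R w" using False by (simp add: vec_eq_iff forall_2 w_def)
    then show ?thesis by blast
  qed
qed

text \<open>An edge of cell \<open>i\<close> is charged to the ordered pair \<open>(i, k)\<close>,
  where \<open>k\<close> touches the edge and is adjacent to \<open>i\<close> in some slice. The
  charging map is injective, so it suffices to count ordered adjacent pairs.\<close>

lemma maximal_cells_edge_count:
  fixes U :: "'i \<Rightarrow> (real^2) set"
  assumes "maximal_cells I U" "card I \<ge> 3"
  shows "(\<Sum>i\<in>I. card {F. F edge_of closure (U i)}) \<le> 6 * card I - 12"
proof -
  interpret maximal_cells I U by fact
  define \<Sigma> where "\<Sigma> = (SIGMA i:I. {F. F edge_of closure (U i)})"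
  have finE: "finite {F. F edge_of closure (U i)}" if "i \<in> I" for i
    using finite_polyhedron_faces[OF polyhedron_closure_cell[OF that]]
    by (rule rev_finite_subset) (auto simp: edge_of_def)
  then have fin\<Sigma>: "finite \<Sigma>" using finite_I by (simp add: \<Sigma>_def)
  have "\<exists>m d. m \<in> rel_interior F \<and> d \<noteq> 0 \<and> m + d \<in> F \<and> m - d \<in> F" if F: "F edge_of S" for F S :: "(real^2) set"
  proof -
    have F': "convex F" "aff_dim F = 1" using F by (auto simp: edge_of_def face_of_imp_convex)
    then have "F \<noteq> {}" by auto
    then obtain m where "m \<in> rel_interior F" using F'(1) rel_interior_eq_empty by blast
    then show ?thesis using rel_interior_symmetric_segment F'(2) by (metis order_refl)
  qed
  then have "\<forall>\<sigma>\<in>\<Sigma>. \<exists>md. fst md \<in> rel_interior (snd \<sigma>) \<and> snd md \<noteq> 0 \<and>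
      fst md + snd md \<in> snd \<sigma> \<and> fst md - snd md \<in> snd \<sigma>"
    unfolding \<Sigma>_def by force
  from bchoice[OF this] obtain md where md: "\<And>\<sigma>. \<sigma> \<in> \<Sigma> \<Longrightarrow> fst (md \<sigma>) \<in> rel_interior (snd \<sigma>) \<and>
      snd (md \<sigma>) \<noteq> 0 \<and> fst (md \<sigma>) + snd (md \<sigma>) \<in> snd \<sigma> \<and> fst (md \<sigma>) - snd (md \<sigma>) \<in> snd \<sigma>"
    by blast
  define m d where "m \<sigma> = fst (md \<sigma>)" and "d \<sigma> = snd (md \<sigma>)" for \<sigma>
  \<comment> \<open>Including \<open>axis 1 1\<close> ensures \<open>u \<noteq> 0\<close> also when
    no cell has an edge.\<close>
  have "finite (insert (axis 1 1) (d ` \<Sigma>))" "0 \<notin> insert (axis 1 1) (d ` \<Sigma>)"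
    using fin\<Sigma> md by (auto simp: d_def axis_eq_0_iff)
  then obtain u where u: "\<forall>v\<in>insert (axis 1 1) (d ` \<Sigma>). u \<bullet> v \<noteq> 0" using generic_direction by metis
  then have "u \<noteq> 0" by auto
  define w where "w = (vector [- u$2, u$1] :: real^2)"
  interpret sliced_cells I U u w
    using \<open>u \<noteq> 0\<close> orthogonal_direction_plane[OF \<open>u \<noteq> 0\<close>] by unfold_locales (auto simp: w_def)
  have "\<exists>k q x. touch (fst \<sigma>) (m \<sigma>) k q \<and>
      ((k, fst \<sigma>) \<in> adj below (slice x) \<or> (fst \<sigma>, k) \<in> adj below (slice x))" if \<sigma>: "\<sigma> \<in> \<Sigma>" for \<sigma>
  proof -
    let ?i = "fst \<sigma>" and ?F = "snd \<sigma>"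
    have i: "?i \<in> I" and F: "?F face_of closure (U ?i)" "aff_dim ?F = 1"
      using \<sigma> by (auto simp: \<Sigma>_def edge_of_def)
    have sub: "?F \<subseteq> closure (U ?i)" using F(1) by (rule face_of_imp_subset)
    have mF: "m \<sigma> \<in> ?F" using md[OF \<sigma>] rel_interior_subset by (auto simp: m_def)
    \<comment> \<open>A cell has dimension two, so an edge is a proper face and avoids the interior;
      hence \<open>m \<sigma>\<close> is a boundary point, as the existence of a contact
      requires.\<close>
    have "?F \<noteq> closure (U ?i)"
    proof
      assume "?F = closure (U ?i)"
      then have "aff_dim (closure (U ?i)) = 1" using F(2) by simp
      moreover have "interior (closure (U ?i)) \<noteq> {}"
        using interior_closure_cell[OF i] nonempty_U[OF i] by simp
      ultimately show False using aff_dim_nonempty_interior[of "closure (U ?i)"] by simp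
    qed
    then have "m \<sigma> \<notin> U ?i"
      using face_of_disjoint_interior[OF F(1)] mF interior_closure_cell[OF i] by blast
    then obtain k q where kq: "touch ?i (m \<sigma>) k q" using touch_exists[OF i] mF sub by blast
    have "u \<bullet> d \<sigma> \<noteq> 0" using u \<sigma> by blast
    moreover have "m \<sigma> + d \<sigma> \<in> closure (U ?i)" "m \<sigma> - d \<sigma> \<in> closure (U ?i)"
      using md[OF \<sigma>] sub by (auto simp: m_def d_def)
    ultimately show ?thesis using touch_adjacent[OF i kq] mF sub by blast
  qed
  then obtain k q x where kqx: "\<And>\<sigma>. \<sigma> \<in> \<Sigma> \<Longrightarrow> touch (fst \<sigma>) (m \<sigma>) (k \<sigma>) (q \<sigma>)"
    "\<And>\<sigma>. \<sigma> \<in> \<Sigma> \<Longrightarrow> (k \<sigma>, fst \<sigma>) \<in> adj below (slice (x \<sigma>)) \<or> (fst \<sigma>, k \<sigma>) \<in> adj below (slice (x \<sigma>))"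
    by metis
  define V where "V = (\<Union>y\<in>x ` \<Sigma>. adj below (slice y))"
  have "slice y \<subseteq> I" for y by (auto simp: slice_def)
  then have cV: "card V \<le> 3 * card I - 6"
    unfolding V_def using fin\<Sigma> finite_I assms(2) lin_on_slice slice_convex
    by (intro card_adjacent_pairs) auto
  have finV: "finite V"
    unfolding V_def using fin\<Sigma> finite_slice finite_adj by blast
  have "inj_on (\<lambda>\<sigma>. (fst \<sigma>, k \<sigma>)) \<Sigma>"
  proof (rule inj_onI)
    fix \<sigma> \<sigma>' assume \<sigma>: "\<sigma> \<in> \<Sigma>" "\<sigma>' \<in> \<Sigma>" and eq: "(fst \<sigma>, k \<sigma>) = (fst \<sigma>', k \<sigma>')"
    have "snd \<sigma> = snd \<sigma>'"
    proof (rule touched_facet_unique)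
      show "fst \<sigma> \<in> I" "snd \<sigma> face_of closure (U (fst \<sigma>))" "snd \<sigma>' face_of closure (U (fst \<sigma>))"
        "aff_dim (snd \<sigma>) = int DIM(real^2) - 1" "aff_dim (snd \<sigma>') = int DIM(real^2) - 1"
        using \<sigma> eq by (auto simp: \<Sigma>_def edge_of_def)
      show "m \<sigma> \<in> rel_interior (snd \<sigma>)" "m \<sigma>' \<in> rel_interior (snd \<sigma>')"
        using md \<sigma> by (auto simp: m_def)
      show "touch (fst \<sigma>) (m \<sigma>) (k \<sigma>) (q \<sigma>)" "touch (fst \<sigma>) (m \<sigma>') (k \<sigma>) (q \<sigma>')"
        using kqx(1)[OF \<sigma>(1)] kqx(1)[OF \<sigma>(2)] eq by auto
    qed
    then show "\<sigma> = \<sigma>'" using eq by (simp add: prod_eq_iff)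
  qed
  then have "card \<Sigma> = card ((\<lambda>\<sigma>. (fst \<sigma>, k \<sigma>)) ` \<Sigma>)" by (simp add: card_image)
  \<comment> \<open>An adjacency lists the lower cell first, a charge lists the charging cell first;
    hence the converse.\<close>
  also have "\<dots> \<le> card (V \<union> V\<inverse>)"
    using kqx(2) finV by (intro card_mono) (fastforce simp: V_def)+
  also have "\<dots> \<le> card V + card (V\<inverse>)" by (rule card_Un_le)
  also have "\<dots> = 2 * card V" by simp
  also have "\<dots> \<le> 6 * card I - 12" using cV by simp
  finally show ?thesis using finite_I finE by (simp add: \<Sigma>_def)
qed

section \<open>Open cells around the compact sets\<close>

lemma disjoint_compact_separated:
  fixes D :: "'i \<Rightarrow> 'a::heine_borel set"
  assumes "finite I" "\<And>i. i \<in> I \<Longrightarrow> compact (D i)" "disjoint_family_on D I"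
  shows "\<exists>e>0. \<forall>i\<in>I. \<forall>k\<in>I. i \<noteq> k \<longrightarrow> (\<forall>x\<in>D i. \<forall>y\<in>D k. e \<le> dist x y)"
proof -
  have "\<exists>e>0. i \<noteq> k \<longrightarrow> (\<forall>x\<in>D i. \<forall>y\<in>D k. e \<le> dist x y)" if "i \<in> I" "k \<in> I" for i k
  proof (cases "i = k")
    case False
    then have "D i \<inter> D k = {}" using assms(3) that by (simp add: disjoint_family_on_def)
    then show ?thesis
      using separate_compact_closed[of "D i" "D k"] assms(2) that compact_imp_closed by blast
  qed (use zero_less_one in blast)
  then obtain e where e: "\<And>i k. i \<in> I \<Longrightarrow> k \<in> I \<Longrightarrow>
      e i k > 0 \<and> (i \<noteq> k \<longrightarrow> (\<forall>x\<in>D i. \<forall>y\<in>D k. e i k \<le> dist x y))" by metis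
  \<comment> \<open>The element 1 keeps the minimum meaningful when \<open>I\<close> is
    empty.\<close>
  define E where "E = insert 1 ((\<lambda>(i, k). e i k) ` (I \<times> I))"
  have E: "finite E" "E \<noteq> {}" using assms(1) by (auto simp: E_def)
  have "\<forall>r\<in>E. r > 0" using e by (auto simp: E_def)
  then have pos: "Min E > 0" using E by (simp add: Min_gr_iff)
  have "Min E \<le> e i k" if "i \<in> I" "k \<in> I" for i k
    using that E by (intro Min_le) (auto simp: E_def)
  then have "Min E \<le> dist x y" if "i \<in> I" "k \<in> I" "i \<noteq> k" "x \<in> D i" "y \<in> D k" for i k x y
    using e[OF that(1,2)] that by fastforce
  with pos show ?thesis by (intro exI[of _ "Min E"]) simp
qed

text \<open>The given sets may be points or segments, while the enlargement starts from open cells.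
  Thickening each set by half of a common lower bound on the distances keeps the sets disjoint, and
  as a Minkowski sum with a ball the result stays convex.\<close>

lemma disjoint_open_neighborhoods:
  fixes D :: "'i \<Rightarrow> 'v::euclidean_space set"
  assumes "finite I" "\<And>i. i \<in> I \<Longrightarrow> compact (D i)" "\<And>i. i \<in> I \<Longrightarrow> convex (D i)" "disjoint_family_on D I"
  shows "\<exists>V. (\<forall>i\<in>I. open (V i) \<and> convex (V i) \<and> D i \<subseteq> V i) \<and> disjoint_family_on V I"
proof -
  obtain e where e: "e > 0" "\<forall>i\<in>I. \<forall>k\<in>I. i \<noteq> k \<longrightarrow> (\<forall>x\<in>D i. \<forall>y\<in>D k. e \<le> dist x y)"
    using disjoint_compact_separated[OF assms(1,2,4)] by blast
  define V where "V i = (\<Union>x\<in>D i. ball x (e / 2))" for i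
  have "open (V i)" for i unfolding V_def by blast
  moreover have "convex (V i)" if "i \<in> I" for i
  proof -
    have "(\<Union>y\<in>ball 0 (e / 2). {x + y}) = ball x (e / 2)" for x :: 'v
    proof (intro set_eqI iffI)
      fix z assume "z \<in> ball x (e / 2)"
      then have "z - x \<in> ball 0 (e / 2)" "z = x + (z - x)" by (auto simp: dist_norm norm_minus_commute)
      then show "z \<in> (\<Union>y\<in>ball 0 (e / 2). {x + y})" by blast
    qed (auto simp: dist_norm)
    then have "V i = (\<Union>x\<in>D i. \<Union>y\<in>ball 0 (e / 2). {x + y})" by (simp add: V_def)
    then show ?thesis using convex_sums[OF assms(3)[OF that] convex_ball] by simp
  qed
  moreover have "D i \<subseteq> V i" for i using e(1) by (auto simp: V_def)
  moreover have "disjoint_family_on V I"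
    unfolding disjoint_family_on_def
  proof (intro ballI impI equals0I)
    fix i k z assume ik: "i \<in> I" "k \<in> I" "i \<noteq> k" and "z \<in> V i \<inter> V k"
    then obtain x x' where x: "x \<in> D i" "dist x z < e / 2" "x' \<in> D k" "dist x' z < e / 2"
      by (auto simp: V_def)
    then have "dist x x' < e" using dist_triangle_half_r[of z x e x'] by (simp add: dist_commute)
    then show False using e(2) ik x by fastforce
  qed
  ultimately show ?thesis by blast
qed

theorem theorem4p8:
  fixes a :: nat
  assumes "a \<ge> 3"
  shows "g a \<le> enat (6 * a - 12)"
proof -
  have "\<exists>P. separating_system a D P \<and> Fac a P \<le> 6 * a - 12" if D: "disjoint_convex_family a D" for D
  proof -
    have D': "\<And>i. i \<in> {1..a} \<Longrightarrow> D i \<noteq> {} \<and> compact (D i) \<and> convex (D i)" "disjoint_family_on D {1..a}"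
      using D by (auto simp: disjoint_convex_family_def)
    obtain V where V: "\<forall>i\<in>{1..a}. open (V i) \<and> convex (V i) \<and> D i \<subseteq> V i" "disjoint_family_on V {1..a}"
      using disjoint_open_neighborhoods[of "{1..a}" D] D' by auto
    then obtain U where U: "maximal_cells {1..a} U" "\<forall>i\<in>{1..a}. V i \<subseteq> U i"
      using maximal_cells_exist[of "{1..a}" V] D' by (metis finite_atLeastAtMost subset_empty)
    interpret maximal_cells "{1..a}" U by (rule U(1))
    have "separating_system a D (\<lambda>i. closure (U i))"
      unfolding separating_system_def disjoint_family_on_def
    proof (intro conjI ballI impI)
      fix i assume i: "i \<in> {1..a}"
      show "polyhedron (closure (U i))" using polyhedron_closure_cell[OF i] .
      show "D i \<subseteq> closure (U i)" using V(1) U(2) i closure_subset[of "U i"] by blast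
      fix k assume "k \<in> {1..a}" "i \<noteq> k"
      then show "interior (closure (U i)) \<inter> interior (closure (U k)) = {}"
        using disjoint_U i by (simp only: interior_closure_cell)
    qed
    moreover have "Fac a (\<lambda>i. closure (U i)) \<le> 6 * a - 12"
      using maximal_cells_edge_count[OF U(1)] assms by (simp add: Fac_def)
    ultimately show ?thesis by blast
  qed
  then show ?thesis unfolding g_def by (intro Inf_lower) blast
qed

end
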